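(* Let $(\Omega,\Sigma,P)$ be a probability space, let $(E_\gamma)_{\gamma\in\Gamma}$ be an arbitrary family of locally convex spaces, and let $E=\sum_{\gamma\in\Gamma}E_\gamma$ be its locally convex direct sum. Then the map $\bar\kappa: L^0(\Omega\!:\!E')\to\mathcal{L}_{\rm c}(E\!:\!L^0(\Omega))$ is surjective if and only if all the maps $\bar\kappa_\gamma: L^0(\Omega\!:\!E_\gamma')\to\mathcal{L}_{\rm c}(E_\gamma\!:\!L^0(\Omega))$, $\gamma\in\Gamma$, are surjective.
   Context: A locally convex space means a Hausdorff locally convex topological vector space over $\mathbb{R}$. The locally convex direct sum $E=\sum_{\gamma\in\Gamma}E_\gamma$ is the algebraic direct sum with the locally convex inductive limit topology with respect to the injections $\iota_\gamma:E_\gamma\to E$, i.e. the finest locally convex topology making all $\iota_\gamma$ continuous. For a locally convex space $F$, $F'$ denotes the space of sequentially continuous linear maps $F\to\mathbb{R}$, equipped with the $\sigma$-algebra generated by the evaluations $T\mapsto T(f)$, $f\in F$. (For the direct sum, $E'=\prod_{\gamma}E_\gamma'$ with the product $\sigma$-algebra.) $L^0(\Omega\!:\!F')$ is the space of measurable maps $\Omega\to F'$ modulo strict equivalence: $X_1,X_2$ are identified iff there is a set $\Omega_1\subset\Omega$ with $P(\Omega_1)=1$ and $X_1(\omega)=X_2(\omega)$ in $F'$ for all $\omega\in\Omega_1$. $L^0(\Omega)$ is the space of real-valued measurable functions on $\Omega$ modulo $P$-almost sure equality, with the topology of convergence in probability, and $\mathcal{L}_{\rm c}(F\!:\!L^0(\Omega))$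 is the space of sequentially continuous linear maps $F\to L^0(\Omega)$. The maps $\bar\kappa$ (for $F=E$) and $\bar\kappa_\gamma$ (for $F=E_\gamma$) send the class $[X]\in L^0(\Omega\!:\!F')$ to the linear map $f\mapsto[\omega\mapsto X(\omega)(f)]$ on $F$; they are well defined. *)

theory Defs
  imports "HOL-Probability.Probability" "HOL-Analysis.Finite_Function_Topology"
begin

section \<open>Locally convex spaces\<close>

text \<open>
  A locally convex space is represented by a topology whose underlying set \<open>topspace T\<close> is a
  linear subspace of some ambient real vector space; the ambient type carries no topology.
  A family of spaces lives in one ambient type \<^typ>\<open>'a\<close>. This is no restriction: the members of
  any family embed linearly in their algebraic direct sum.
\<close>

definition locally_convex_topology :: "'a::real_vector topology \<Rightarrow> bool" where
  "locally_convex_topology T \<longleftrightarrow>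
     subspace (topspace T) \<and>
     continuous_map (prod_topology T T) T (\<lambda>(x, y). x + y) \<and>
     continuous_map (prod_topology euclideanreal T) T (\<lambda>(c, x). c *\<^sub>R x) \<and>
     (\<forall>U. openin T U \<and> 0 \<in> U \<longrightarrow> (\<exists>V. openin T V \<and> convex V \<and> 0 \<in> V \<and> V \<subseteq> U))"

definition locally_convex_space :: "'a::real_vector topology \<Rightarrow> bool" where
  "locally_convex_space T \<longleftrightarrow> locally_convex_topology T \<and> Hausdorff_space T"

definition direct_sum :: "'i set \<Rightarrow> ('i \<Rightarrow> 'a::real_vector set) \<Rightarrow> ('i \<Rightarrow>\<^sub>0 'a) set" where
  "direct_sum \<Gamma> S = {x. Poly_Mapping.keys x \<subseteq> \<Gamma> \<and> (\<forall>\<gamma>\<in>\<Gamma>. Poly_Mapping.lookup x \<gamma> \<in> S \<gamma>)}"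

definition direct_sum_topologies ::
    "'i set \<Rightarrow> ('i \<Rightarrow> 'a::real_vector topology) \<Rightarrow> ('i \<Rightarrow>\<^sub>0 'a) topology set" where
  "direct_sum_topologies \<Gamma> T = {T'. locally_convex_topology T' \<and>
     topspace T' = direct_sum \<Gamma> (\<lambda>\<gamma>. topspace (T \<gamma>)) \<and>
     (\<forall>\<gamma>\<in>\<Gamma>. continuous_map (T \<gamma>) T' (Poly_Mapping.single \<gamma>))}"

text \<open>
  The finest element of \<^term>\<open>direct_sum_topologies \<Gamma> T\<close>, constructed as the supremum of all of
  them; see \<open>direct_sum_topology_in\<close> and \<open>direct_sum_topology_finest\<close> below.
\<close>

definition direct_sum_topology ::
    "'i set \<Rightarrow> ('i \<Rightarrow> 'a::real_vector topology) \<Rightarrow> ('i \<Rightarrow>\<^sub>0 'a) topology" where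
  "direct_sum_topology \<Gamma> T =
     topology_generated_by (\<Union>T' \<in> direct_sum_topologies \<Gamma> T. Collect (openin T'))"


section \<open>Sequential continuity and the sequential dual\<close>

definition seq_continuous_map :: "'a topology \<Rightarrow> 'b topology \<Rightarrow> ('a \<Rightarrow> 'b) \<Rightarrow> bool" where
  "seq_continuous_map T T' f \<longleftrightarrow>
     f \<in> topspace T \<rightarrow> topspace T' \<and>
     (\<forall>x l. range x \<subseteq> topspace T \<and> limitin T x l sequentially
        \<longrightarrow> limitin T' (\<lambda>n. f (x n)) (f l) sequentially)"

text \<open>
  Maps defined on \<open>topspace T\<close> are taken to be \<open>extensional\<close>, so that equality of HOL functions
  is equality of maps on \<open>topspace T\<close>.
\<close>

definition seq_dual :: "'a::real_vector topology \<Rightarrow> ('a \<Rightarrow> real) set" where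
  "seq_dual T = {f \<in> extensional (topspace T).
     (\<forall>x\<in>topspace T. \<forall>y\<in>topspace T. f (x + y) = f x + f y) \<and>
     (\<forall>c. \<forall>x\<in>topspace T. f (c *\<^sub>R x) = c * f x) \<and>
     seq_continuous_map T euclideanreal f}"

definition dual_algebra :: "'a::real_vector topology \<Rightarrow> ('a \<Rightarrow> real) measure" where
  "dual_algebra T = sigma (seq_dual T)
     {(\<lambda>F. F f) -` B \<inter> seq_dual T | f B. f \<in> topspace T \<and> B \<in> sets (borel :: real measure)}"


section \<open>Spaces of equivalence classes of random variables\<close>

definition L0_rel :: "'w measure \<Rightarrow> (('w \<Rightarrow> real) \<times> ('w \<Rightarrow> real)) set" where
  "L0_rel M = {(X, Y). X \<in> borel_measurable M \<and> Y \<in> borel_measurable M \<and>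
                       (AE \<omega> in M. X \<omega> = Y \<omega>)}"

definition L0 :: "'w measure \<Rightarrow> ('w \<Rightarrow> real) set set" where
  "L0 M = borel_measurable M // L0_rel M"

definition L0_class :: "'w measure \<Rightarrow> ('w \<Rightarrow> real) \<Rightarrow> ('w \<Rightarrow> real) set" where
  "L0_class M X = L0_rel M `` {X}"

definition L0_add :: "'w measure \<Rightarrow> ('w \<Rightarrow> real) set \<Rightarrow> ('w \<Rightarrow> real) set \<Rightarrow> ('w \<Rightarrow> real) set" where
  "L0_add M C D = (\<Union>X\<in>C. \<Union>Y\<in>D. L0_class M (\<lambda>\<omega>. X \<omega> + Y \<omega>))"

definition L0_scale :: "'w measure \<Rightarrow> real \<Rightarrow> ('w \<Rightarrow> real) set \<Rightarrow> ('w \<Rightarrow> real) set" where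
  "L0_scale M c C = (\<Union>X\<in>C. L0_class M (\<lambda>\<omega>. c * X \<omega>))"

text \<open>
  The topology of convergence in probability: the neighbourhoods of \<open>C\<close> are the sets containing
  \<open>{D. P(\<bar>C - D\<bar> \<ge> e) < e}\<close> for some \<open>e > 0\<close>. Its convergent sequences are identified
  in \<open>limitin_L0_topology\<close> below.
\<close>

definition L0_topology :: "'w measure \<Rightarrow> ('w \<Rightarrow> real) set topology" where
  "L0_topology M = topology (\<lambda>U. U \<subseteq> L0 M \<and>
     (\<forall>C\<in>U. \<exists>e>0. \<forall>D\<in>L0 M.
        (\<exists>X\<in>C. \<exists>Y\<in>D. measure M {\<omega>\<in>space M. \<bar>X \<omega> - Y \<omega>\<bar> \<ge> e} < e) \<longrightarrow> D \<in> U))"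

definition Lc :: "'w measure \<Rightarrow> 'a::real_vector topology \<Rightarrow> ('a \<Rightarrow> ('w \<Rightarrow> real) set) set" where
  "Lc M T = {\<phi> \<in> extensional (topspace T).
     (\<forall>x\<in>topspace T. \<forall>y\<in>topspace T. \<phi> (x + y) = L0_add M (\<phi> x) (\<phi> y)) \<and>
     (\<forall>c. \<forall>x\<in>topspace T. \<phi> (c *\<^sub>R x) = L0_scale M c (\<phi> x)) \<and>
     seq_continuous_map T (L0_topology M) \<phi>}"

definition strict_rel ::
    "'w measure \<Rightarrow> 'a::real_vector topology \<Rightarrow> (('w \<Rightarrow> 'a \<Rightarrow> real) \<times> ('w \<Rightarrow> 'a \<Rightarrow> real)) set" where
  "strict_rel M T = {(X, Y). X \<in> measurable M (dual_algebra T) \<and> Y \<in> measurable M (dual_algebra T) \<and>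
     (\<exists>\<Omega>\<^sub>1\<in>sets M. measure M \<Omega>\<^sub>1 = 1 \<and> (\<forall>\<omega>\<in>\<Omega>\<^sub>1. X \<omega> = Y \<omega>))}"

definition L0_dual :: "'w measure \<Rightarrow> 'a::real_vector topology \<Rightarrow> ('w \<Rightarrow> 'a \<Rightarrow> real) set set" where
  "L0_dual M T = measurable M (dual_algebra T) // strict_rel M T"

definition kappa_bar ::
    "'w measure \<Rightarrow> 'a::real_vector topology \<Rightarrow> ('w \<Rightarrow> 'a \<Rightarrow> real) set \<Rightarrow> 'a \<Rightarrow> ('w \<Rightarrow> real) set" where
  "kappa_bar M T C = (\<lambda>f\<in>topspace T. \<Union>X\<in>C. L0_class M (\<lambda>\<omega>. X \<omega> f))"


section \<open>The direct sum topology is the finest admissible one\<close>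

lemma subspace_direct_sum:
  assumes "\<And>\<gamma>. \<gamma> \<in> \<Gamma> \<Longrightarrow> subspace (S \<gamma>)"
  shows "subspace (direct_sum \<Gamma> S)"
proof -
  have keys_scale: "Poly_Mapping.keys (c *\<^sub>R x) \<subseteq> Poly_Mapping.keys x" for c and x :: "'a \<Rightarrow>\<^sub>0 'b"
    by (auto simp: in_keys_iff scaleR_poly_mapping_def lookup_Abs_poly_mapping)
  have lookup_scale: "Poly_Mapping.lookup (c *\<^sub>R x) i = c *\<^sub>R Poly_Mapping.lookup x i"
    for c and x :: "'a \<Rightarrow>\<^sub>0 'b" and i
    by (auto simp: scaleR_poly_mapping_def)
  show ?thesis
    unfolding subspace_def
  proof (intro conjI ballI allI)
    show "0 \<in> direct_sum \<Gamma> S"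
      using assms by (auto simp: direct_sum_def subspace_0)
  next
    fix x y assume "x \<in> direct_sum \<Gamma> S" "y \<in> direct_sum \<Gamma> S"
    then show "x + y \<in> direct_sum \<Gamma> S"
      using assms Poly_Mapping.keys_add[of x y]
      by (auto simp: direct_sum_def lookup_add subspace_add)
  next
    fix c :: real and x assume "x \<in> direct_sum \<Gamma> S"
    then show "c *\<^sub>R x \<in> direct_sum \<Gamma> S"
      using assms keys_scale[of c x] by (auto simp: direct_sum_def lookup_scale subspace_scale)
  qed
qed

lemma single_in_direct_sum:
  assumes "\<And>\<gamma>. \<gamma> \<in> \<Gamma> \<Longrightarrow> subspace (S \<gamma>)" "\<gamma> \<in> \<Gamma>" "x \<in> S \<gamma>"
  shows "Poly_Mapping.single \<gamma> x \<in> direct_sum \<Gamma> S"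
  using assms by (auto simp: direct_sum_def lookup_single when_def subspace_0)

lemma locally_convex_indiscrete:
  assumes "subspace S"
  shows "locally_convex_topology (pullback_topology S (\<lambda>_. 0::real) euclideanreal)"
    and "topspace (pullback_topology S (\<lambda>_. 0::real) euclideanreal) = S"
proof -
  let ?T = "pullback_topology S (\<lambda>_. 0::real) euclideanreal"
  show ts: "topspace ?T = S" by (simp add: topspace_pullback_topology)
  have op: "openin ?T U \<Longrightarrow> U = {} \<or> U = S" for U
    by (cases "U = {}") (auto simp: openin_pullback_topology split: if_splits)
  show "locally_convex_topology ?T"
    unfolding locally_convex_topology_def ts
  proof (intro conjI allI impI)
    show "continuous_map (prod_topology ?T ?T) ?T (\<lambda>(x, y). x + y)"
      by (intro continuous_map_pullback')
         (auto simp: o_def ts assms subspace_add split_def)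
    show "continuous_map (prod_topology euclideanreal ?T) ?T (\<lambda>(c, x). c *\<^sub>R x)"
      by (intro continuous_map_pullback')
         (auto simp: o_def ts assms subspace_scale split_def)
    fix U assume "openin ?T U \<and> 0 \<in> U"
    then show "\<exists>V. openin ?T V \<and> convex V \<and> 0 \<in> V \<and> V \<subseteq> U"
      using op assms subspace_imp_convex by blast
  qed fact
qed

lemma direct_sum_topology_finest:
  assumes "T' \<in> direct_sum_topologies \<Gamma> T" "openin T' U"
  shows "openin (direct_sum_topology \<Gamma> T) U"
  unfolding direct_sum_topology_def by (rule topology_generated_by_Basis) (use assms in auto)

lemma indiscrete_in_direct_sum_topologies:
  assumes lc: "\<And>\<gamma>. \<gamma> \<in> \<Gamma> \<Longrightarrow> locally_convex_topology (T \<gamma>)"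
  shows "pullback_topology (direct_sum \<Gamma> (\<lambda>\<gamma>. topspace (T \<gamma>))) (\<lambda>_. 0::real) euclideanreal
           \<in> direct_sum_topologies \<Gamma> T"
proof -
  let ?E = "direct_sum \<Gamma> (\<lambda>\<gamma>. topspace (T \<gamma>))"
  have ss: "\<And>\<gamma>. \<gamma> \<in> \<Gamma> \<Longrightarrow> subspace (topspace (T \<gamma>))"
    using lc by (simp add: locally_convex_topology_def)
  have sub: "subspace ?E" by (rule subspace_direct_sum) (rule ss)
  have "continuous_map (T \<gamma>) (pullback_topology ?E (\<lambda>_. 0::real) euclideanreal) (Poly_Mapping.single \<gamma>)"
    if "\<gamma> \<in> \<Gamma>" for \<gamma>
  proof (rule continuous_map_pullback')
    show "topspace (T \<gamma>) \<subseteq> Poly_Mapping.single \<gamma> -` ?E"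
      using that single_in_direct_sum[of \<Gamma> "\<lambda>\<gamma>. topspace (T \<gamma>)" \<gamma>] ss by auto
  qed (simp add: o_def)
  with locally_convex_indiscrete[OF sub] show ?thesis
    by (auto simp: direct_sum_topologies_def)
qed

lemma topspace_direct_sum_topology:
  assumes lc: "\<And>\<gamma>. \<gamma> \<in> \<Gamma> \<Longrightarrow> locally_convex_topology (T \<gamma>)"
  shows "topspace (direct_sum_topology \<Gamma> T) = direct_sum \<Gamma> (\<lambda>\<gamma>. topspace (T \<gamma>))" (is "_ = ?E")
proof -
  let ?I = "pullback_topology ?E (\<lambda>_. 0::real) euclideanreal"
  have I: "?I \<in> direct_sum_topologies \<Gamma> T"
    by (rule indiscrete_in_direct_sum_topologies) (rule lc)
  then have "topspace ?I = ?E" by (simp add: direct_sum_topologies_def)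
  with openin_topspace[of ?I] have "openin ?I ?E" by simp
  moreover have "\<And>T' U. T' \<in> direct_sum_topologies \<Gamma> T \<Longrightarrow> openin T' U \<Longrightarrow> U \<subseteq> ?E"
    using openin_subset by (fastforce simp: direct_sum_topologies_def)
  ultimately show ?thesis
    unfolding direct_sum_topology_def topology_generated_by_topspace using I by blast
qed

lemma continuous_map_into_direct_sum_topology:
  assumes lc: "\<And>\<gamma>. \<gamma> \<in> \<Gamma> \<Longrightarrow> locally_convex_topology (T \<gamma>)"
    and f: "\<And>T'. T' \<in> direct_sum_topologies \<Gamma> T \<Longrightarrow> continuous_map A T' f"
  shows "continuous_map A (direct_sum_topology \<Gamma> T) f"
  unfolding direct_sum_topology_def
proof (rule continuous_on_generated_topo)
  show "openin A (f -` U \<inter> topspace A)"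
    if "U \<in> (\<Union>T' \<in> direct_sum_topologies \<Gamma> T. Collect (openin T'))" for U
    using that f by (auto simp: continuous_map_alt)
  let ?E = "direct_sum \<Gamma> (\<lambda>\<gamma>. topspace (T \<gamma>))"
  let ?I = "pullback_topology ?E (\<lambda>_. 0::real) euclideanreal"
  have I: "?I \<in> direct_sum_topologies \<Gamma> T"
    by (rule indiscrete_in_direct_sum_topologies) (rule lc)
  then have ts: "topspace ?I = ?E" by (simp add: direct_sum_topologies_def)
  have "f ` topspace A \<subseteq> ?E"
    using f[OF I] ts by (auto simp: continuous_map_def)
  also have "?E = \<Union>(\<Union>T' \<in> direct_sum_topologies \<Gamma> T. Collect (openin T'))"
    using topspace_direct_sum_topology[where \<Gamma>=\<Gamma> and T=T, OF lc]
    unfolding direct_sum_topology_def by simp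
  finally show "f ` topspace A \<subseteq> \<Union>(\<Union>T' \<in> direct_sum_topologies \<Gamma> T. Collect (openin T'))" .
qed

lemma direct_sum_topology_in:
  assumes lc: "\<And>\<gamma>. \<gamma> \<in> \<Gamma> \<Longrightarrow> locally_convex_topology (T \<gamma>)"
  shows "direct_sum_topology \<Gamma> T \<in> direct_sum_topologies \<Gamma> T"
proof -
  let ?G = "direct_sum_topology \<Gamma> T"
  let ?E = "direct_sum \<Gamma> (\<lambda>\<gamma>. topspace (T \<gamma>))"
  have ts: "topspace ?G = ?E" by (rule topspace_direct_sum_topology) (rule lc)
  have sub: "subspace ?E"
    by (rule subspace_direct_sum) (use lc in \<open>simp add: locally_convex_topology_def\<close>)
  note into = continuous_map_into_direct_sum_topology[where \<Gamma>=\<Gamma> and T=T, OF lc]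
  have id: "continuous_map ?G T' (\<lambda>x. x)" if T': "T' \<in> direct_sum_topologies \<Gamma> T" for T'
    unfolding continuous_map_alt
  proof (intro conjI allI impI)
    fix U assume "openin T' U"
    with T' show "openin ?G ((\<lambda>x. x) -` U \<inter> topspace ?G)"
      by (auto intro: openin_Int direct_sum_topology_finest)
  qed (use T' ts in \<open>auto simp: direct_sum_topologies_def\<close>)
  have single: "continuous_map (T \<gamma>) ?G (Poly_Mapping.single \<gamma>)" if "\<gamma> \<in> \<Gamma>" for \<gamma>
    by (rule into) (use that in \<open>auto simp: direct_sum_topologies_def\<close>)
  have add: "continuous_map (prod_topology ?G ?G) ?G (\<lambda>(x, y). x + y)"
  proof (rule into)
    fix T' assume T': "T' \<in> direct_sum_topologies \<Gamma> T"
    have 1: "continuous_map (prod_topology ?G ?G) (prod_topology T' T') (\<lambda>(x, y). (x, y))"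
      by (subst continuous_map_prod_top) (simp add: id[OF T'])
    have 2: "continuous_map (prod_topology T' T') T' (\<lambda>(x, y). x + y)"
      using T' by (auto simp: direct_sum_topologies_def locally_convex_topology_def)
    show "continuous_map (prod_topology ?G ?G) T' (\<lambda>(x, y). x + y)"
      using continuous_map_compose[OF 1 2] by (simp add: o_def split_def)
  qed
  have scale: "continuous_map (prod_topology euclideanreal ?G) ?G (\<lambda>(c, x). c *\<^sub>R x)"
  proof (rule into)
    fix T' assume T': "T' \<in> direct_sum_topologies \<Gamma> T"
    have 1: "continuous_map (prod_topology euclideanreal ?G) (prod_topology euclideanreal T') (\<lambda>(x, y). (x, y))"
      by (subst continuous_map_prod_top) (simp add: id[OF T'])
    have 2: "continuous_map (prod_topology euclideanreal T') T' (\<lambda>(c, x). c *\<^sub>R x)"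
      using T' by (auto simp: direct_sum_topologies_def locally_convex_topology_def)
    show "continuous_map (prod_topology euclideanreal ?G) T' (\<lambda>(c, x). c *\<^sub>R x)"
      using continuous_map_compose[OF 1 2] by (simp add: o_def split_def)
  qed
  have conv: "\<exists>V. openin ?G V \<and> convex V \<and> 0 \<in> V \<and> V \<subseteq> U" if "openin ?G U" "0 \<in> U" for U
  proof -
    have "generate_topology_on (\<Union>T' \<in> direct_sum_topologies \<Gamma> T. Collect (openin T')) U"
      using that(1) by (simp add: direct_sum_topology_def openin_topology_generated_by_iff)
    then have "0 \<in> U \<longrightarrow> (\<exists>V. openin ?G V \<and> convex V \<and> 0 \<in> V \<and> V \<subseteq> U)"
    proof induction
      case (Int a b)
      show ?case
      proof
        assume "0 \<in> a \<inter> b"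
        then obtain V W where "openin ?G V \<and> convex V \<and> 0 \<in> V \<and> V \<subseteq> a"
            "openin ?G W \<and> convex W \<and> 0 \<in> W \<and> W \<subseteq> b" using Int by auto
        then show "\<exists>V. openin ?G V \<and> convex V \<and> 0 \<in> V \<and> V \<subseteq> a \<inter> b"
          by (intro exI[of _ "V \<inter> W"]) (auto simp: convex_Int)
      qed
    next
      case (UN K)
      show ?case
      proof
        assume "0 \<in> \<Union>K"
        then obtain k where k: "k \<in> K" "0 \<in> k" by blast
        then have "\<exists>V. openin ?G V \<and> convex V \<and> 0 \<in> V \<and> V \<subseteq> k"
          using UN.IH by simp
        with k(1) show "\<exists>V. openin ?G V \<and> convex V \<and> 0 \<in> V \<and> V \<subseteq> \<Union>K"
          by (meson Union_upper subset_trans)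
      qed
    next
      case (Basis s)
      then obtain T' where T': "T' \<in> direct_sum_topologies \<Gamma> T" "openin T' s" by auto
      show ?case
      proof
        assume "0 \<in> s"
        then obtain V where "openin T' V" "convex V" "0 \<in> V" "V \<subseteq> s"
          using T' unfolding direct_sum_topologies_def locally_convex_topology_def by blast
        then show "\<exists>V. openin ?G V \<and> convex V \<and> 0 \<in> V \<and> V \<subseteq> s"
          using direct_sum_topology_finest[OF T'(1)] by blast
      qed
    qed auto
    with that(2) show ?thesis by simp
  qed
  show ?thesis
    unfolding direct_sum_topologies_def locally_convex_topology_def
    using ts sub single add scale conv by simp
qed


section \<open>Convergence in probability\<close>

lemma equiv_L0_rel: "equiv (borel_measurable M) (L0_rel M)"
proof (rule equivI)
  show "L0_rel M \<subseteq> borel_measurable M \<times> borel_measurable M" by (auto simp: L0_rel_def)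
  show "refl_on (borel_measurable M) (L0_rel M)" by (auto simp: refl_on_def L0_rel_def)
  show "sym (L0_rel M)" by (auto simp: sym_def L0_rel_def elim: AE_mp)
  show "trans (L0_rel M)" by (auto simp: trans_def L0_rel_def elim: AE_mp)
qed

context prob_space
begin

lemma L0_topology_prob_cong:
  assumes "(X, X') \<in> L0_rel M" "(Y, Y') \<in> L0_rel M"
  shows "prob {\<omega>\<in>space M. \<bar>X \<omega> - Y \<omega>\<bar> \<ge> e} = prob {\<omega>\<in>space M. \<bar>X' \<omega> - Y' \<omega>\<bar> \<ge> e}"
  by (rule measure_eq_AE) (use assms in \<open>auto simp: L0_rel_def elim!: AE_mp\<close>)

lemma openin_L0_topology:
  "openin (L0_topology M) U \<longleftrightarrow> U \<subseteq> L0 M \<and>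
     (\<forall>C\<in>U. \<exists>e>0. \<forall>D\<in>L0 M.
        (\<exists>X\<in>C. \<exists>Y\<in>D. prob {\<omega>\<in>space M. \<bar>X \<omega> - Y \<omega>\<bar> \<ge> e} < e) \<longrightarrow> D \<in> U)"
  (is "_ \<longleftrightarrow> ?P U")
proof -
  have meas: "X \<in> borel_measurable M" if "C \<in> L0 M" "X \<in> C" for C X
    using that by (auto simp: L0_def quotient_def L0_rel_def)
  have mono: "prob {\<omega>\<in>space M. \<bar>X \<omega> - Y \<omega>\<bar> \<ge> e'} < e'"
    if "C \<in> L0 M" "D \<in> L0 M" "X \<in> C" "Y \<in> D" "e \<le> e'"
       "prob {\<omega>\<in>space M. \<bar>X \<omega> - Y \<omega>\<bar> \<ge> e} < e" for C D X Y e e'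
  proof -
    have [measurable]: "X \<in> borel_measurable M" "Y \<in> borel_measurable M" using that meas by auto
    have "prob {\<omega>\<in>space M. \<bar>X \<omega> - Y \<omega>\<bar> \<ge> e'} \<le> prob {\<omega>\<in>space M. \<bar>X \<omega> - Y \<omega>\<bar> \<ge> e}"
      using that by (intro finite_measure_mono) auto
    with that show ?thesis by linarith
  qed
  have "?P (S \<inter> U)" if S: "?P S" and U: "?P U" for S U
  proof -
    show "?P (S \<inter> U)"
    proof (intro conjI ballI)
      show "S \<inter> U \<subseteq> L0 M" using S by auto
      fix C assume C: "C \<in> S \<inter> U"
      obtain e where e: "e > 0"
        "\<And>D. D\<in>L0 M \<Longrightarrow> (\<exists>X\<in>C. \<exists>Y\<in>D. prob {\<omega>\<in>space M. \<bar>X \<omega> - Y \<omega>\<bar> \<ge> e} < e) \<Longrightarrow> D \<in> S"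
        using C S by blast
      obtain e' where e': "e' > 0"
        "\<And>D. D\<in>L0 M \<Longrightarrow> (\<exists>X\<in>C. \<exists>Y\<in>D. prob {\<omega>\<in>space M. \<bar>X \<omega> - Y \<omega>\<bar> \<ge> e'} < e') \<Longrightarrow> D \<in> U"
        using C U by blast
      have CL: "C \<in> L0 M" using C S by auto
      show "\<exists>e>0. \<forall>D\<in>L0 M.
        (\<exists>X\<in>C. \<exists>Y\<in>D. prob {\<omega>\<in>space M. \<bar>X \<omega> - Y \<omega>\<bar> \<ge> e} < e) \<longrightarrow> D \<in> S \<inter> U"
      proof (intro exI[of _ "min e e'"] conjI ballI impI)
        show "min e e' > 0" using e e' by simp
        fix D assume D: "D \<in> L0 M"
          "\<exists>X\<in>C. \<exists>Y\<in>D. prob {\<omega>\<in>space M. \<bar>X \<omega> - Y \<omega>\<bar> \<ge> min e e'} < min e e'"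
        then obtain X Y where XY: "X \<in> C" "Y \<in> D"
          "prob {\<omega>\<in>space M. \<bar>X \<omega> - Y \<omega>\<bar> \<ge> min e e'} < min e e'" by blast
        have "D \<in> S"
          by (rule e(2)[OF D(1)]) (use XY mono[OF CL D(1) XY(1,2) min.cobounded1 XY(3)] in blast)
        moreover have "D \<in> U"
          by (rule e'(2)[OF D(1)]) (use XY mono[OF CL D(1) XY(1,2) min.cobounded2 XY(3)] in blast)
        ultimately show "D \<in> S \<inter> U" by blast
      qed
    qed
  qed
  moreover have "?P (\<Union>\<K>)" if K: "\<forall>K\<in>\<K>. ?P K" for \<K>
  proof (intro conjI ballI)
    show "\<Union>\<K> \<subseteq> L0 M" using K by blast
    fix C assume "C \<in> \<Union>\<K>"
    then obtain K where KC: "K \<in> \<K>" "C \<in> K" by blast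
    with K obtain e where "e > 0" "\<forall>D\<in>L0 M.
        (\<exists>X\<in>C. \<exists>Y\<in>D. prob {\<omega>\<in>space M. \<bar>X \<omega> - Y \<omega>\<bar> \<ge> e} < e) \<longrightarrow> D \<in> K" by blast
    with KC show "\<exists>e>0. \<forall>D\<in>L0 M.
        (\<exists>X\<in>C. \<exists>Y\<in>D. prob {\<omega>\<in>space M. \<bar>X \<omega> - Y \<omega>\<bar> \<ge> e} < e) \<longrightarrow> D \<in> \<Union>\<K>" by blast
  qed
  ultimately have "istopology ?P" unfolding istopology_def by simp
  from topology_inverse'[OF this] show ?thesis unfolding L0_topology_def by simp
qed

lemma topspace_L0_topology: "topspace (L0_topology M) = L0 M"
proof
  have "openin (L0_topology M) (L0 M)" unfolding openin_L0_topology by (auto intro: exI[of _ 1])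
  then show "L0 M \<subseteq> topspace (L0_topology M)" by (rule openin_subset)
  show "topspace (L0_topology M) \<subseteq> L0 M"
    using openin_topspace[of "L0_topology M"] unfolding openin_L0_topology by auto
qed

lemma L0_classI: "X \<in> borel_measurable M \<Longrightarrow> X \<in> L0_class M X"
  by (auto simp: L0_class_def L0_rel_def)

lemma L0_class_in_L0: "X \<in> borel_measurable M \<Longrightarrow> L0_class M X \<in> L0 M"
  by (auto simp: L0_class_def L0_def quotient_def)

lemma limitin_L0_topology:
  assumes [measurable]: "\<And>n. X n \<in> borel_measurable M" "Y \<in> borel_measurable M"
  shows "limitin (L0_topology M) (\<lambda>n. L0_class M (X n)) (L0_class M Y) sequentially \<longleftrightarrow>
         (\<forall>e>0. (\<lambda>n. prob {\<omega>\<in>space M. \<bar>X n \<omega> - Y \<omega>\<bar> \<ge> e}) \<longlonglongrightarrow> 0)"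
    (is "?L \<longleftrightarrow> ?R")
proof
  assume R: ?R
  show ?L
    unfolding limitin_def topspace_L0_topology
  proof (intro conjI allI impI)
    show "L0_class M Y \<in> L0 M" by (simp add: L0_class_in_L0)
    fix U assume U: "openin (L0_topology M) U \<and> L0_class M Y \<in> U"
    then obtain e where e: "e > 0"
      "\<And>D X Y'. \<lbrakk>D \<in> L0 M; Y' \<in> L0_class M Y; X \<in> D;
         prob {\<omega>\<in>space M. \<bar>Y' \<omega> - X \<omega>\<bar> \<ge> e} < e\<rbrakk> \<Longrightarrow> D \<in> U"
      unfolding openin_L0_topology by blast
    have "\<forall>\<^sub>F n in sequentially. prob {\<omega>\<in>space M. \<bar>X n \<omega> - Y \<omega>\<bar> \<ge> e} < e"
      using R e(1) order_tendstoD(2) by blast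
    then show "\<forall>\<^sub>F n in sequentially. L0_class M (X n) \<in> U"
    proof eventually_elim
      case (elim n)
      then show ?case
        by (intro e(2)[OF _ L0_classI L0_classI]) (auto simp: L0_class_in_L0 abs_minus_commute)
    qed
  qed
next
  assume L: ?L
  have ev: "\<forall>\<^sub>F n in sequentially. prob {\<omega>\<in>space M. \<bar>X n \<omega> - Y \<omega>\<bar> \<ge> e} < e" if "e > 0" for e
  proof -
    define U where "U = {D \<in> L0 M. \<exists>Z\<in>D. \<exists>d>0. d < e \<and> prob {\<omega>\<in>space M. \<bar>Y \<omega> - Z \<omega>\<bar> \<ge> d} < d}"
    have "openin (L0_topology M) U"
      unfolding openin_L0_topology
    proof (intro conjI ballI)
      show "U \<subseteq> L0 M" by (auto simp: U_def)
      fix C assume C: "C \<in> U"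
      then obtain Z d where Z: "C \<in> L0 M" "Z \<in> C" "d > 0" "d < e"
        "prob {\<omega>\<in>space M. \<bar>Y \<omega> - Z \<omega>\<bar> \<ge> d} < d" by (auto simp: U_def)
      define \<delta> where "\<delta> = (e - d) / 2"
      have \<delta>: "\<delta> > 0" "d + \<delta> < e" using Z by (auto simp: \<delta>_def field_simps)
      show "\<exists>e>0. \<forall>D\<in>L0 M.
        (\<exists>X\<in>C. \<exists>Y\<in>D. prob {\<omega>\<in>space M. \<bar>X \<omega> - Y \<omega>\<bar> \<ge> e} < e) \<longrightarrow> D \<in> U"
      proof (intro exI[of _ \<delta>] conjI ballI impI \<delta>)
        fix D assume D: "D \<in> L0 M" "\<exists>X\<in>C. \<exists>Y\<in>D. prob {\<omega>\<in>space M. \<bar>X \<omega> - Y \<omega>\<bar> \<ge> \<delta>} < \<delta>"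
        then obtain X' W where W: "X' \<in> C" "W \<in> D"
          "prob {\<omega>\<in>space M. \<bar>X' \<omega> - W \<omega>\<bar> \<ge> \<delta>} < \<delta>" by auto
        have rel: "(X', Z) \<in> L0_rel M"
          using Z W quotient_eq_iff[OF equiv_L0_rel] unfolding L0_def by blast
        have relW: "(W, W) \<in> L0_rel M"
          using D W quotient_eq_iff[OF equiv_L0_rel] unfolding L0_def by blast
        have [measurable]: "Z \<in> borel_measurable M" "W \<in> borel_measurable M"
          using rel relW by (auto simp: L0_rel_def)
        have ZW: "prob {\<omega>\<in>space M. \<bar>Z \<omega> - W \<omega>\<bar> \<ge> \<delta>} < \<delta>"
          using W(3) L0_topology_prob_cong[OF rel relW] by simp
        have "prob {\<omega>\<in>space M. \<bar>Y \<omega> - W \<omega>\<bar> \<ge> d + \<delta>} \<le>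
          prob ({\<omega>\<in>space M. \<bar>Y \<omega> - Z \<omega>\<bar> \<ge> d} \<union> {\<omega>\<in>space M. \<bar>Z \<omega> - W \<omega>\<bar> \<ge> \<delta>})"
          by (intro finite_measure_mono) auto
        also have "\<dots> \<le> prob {\<omega>\<in>space M. \<bar>Y \<omega> - Z \<omega>\<bar> \<ge> d} + prob {\<omega>\<in>space M. \<bar>Z \<omega> - W \<omega>\<bar> \<ge> \<delta>}"
          by (intro measure_Un_le) auto
        also have "\<dots> < d + \<delta>" using Z ZW by linarith
        finally show "D \<in> U"
          unfolding U_def using D W \<delta> Z(3) by (auto intro!: bexI[of _ W] exI[of _ "d + \<delta>"])
      qed
    qed
    moreover have "L0_class M Y \<in> U"
      unfolding U_def using that
      by (auto simp: L0_class_in_L0 intro!: bexI[of _ Y] exI[of _ "e / 2"] L0_classI)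
    ultimately have "\<forall>\<^sub>F n in sequentially. L0_class M (X n) \<in> U"
      using L by (auto simp: limitin_def)
    then show ?thesis
    proof eventually_elim
      case (elim n)
      then obtain Z d where Z: "Z \<in> L0_class M (X n)" "d > 0" "d < e"
        "prob {\<omega>\<in>space M. \<bar>Y \<omega> - Z \<omega>\<bar> \<ge> d} < d" by (auto simp: U_def)
      have "(X n, Z) \<in> L0_rel M" using Z by (auto simp: L0_class_def)
      moreover have "(Y, Y) \<in> L0_rel M" by (auto simp: L0_rel_def)
      ultimately have "prob {\<omega>\<in>space M. \<bar>Y \<omega> - X n \<omega>\<bar> \<ge> d} < d"
        using Z(4) L0_topology_prob_cong[of Y Y "X n" Z d] by simp
      moreover have "prob {\<omega>\<in>space M. \<bar>X n \<omega> - Y \<omega>\<bar> \<ge> e} \<le> prob {\<omega>\<in>space M. \<bar>Y \<omega> - X n \<omega>\<bar> \<ge> d}"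
        using Z(3) by (intro finite_measure_mono) auto
      ultimately show ?case using Z by linarith
    qed
  qed
  show ?R
  proof (intro allI impI)
    fix e :: real assume e: "e > 0"
    show "(\<lambda>n. prob {\<omega>\<in>space M. \<bar>X n \<omega> - Y \<omega>\<bar> \<ge> e}) \<longlonglongrightarrow> 0"
    proof (rule order_tendstoI)
      fix r :: real assume "r > 0"
      with e have "min e r > 0" by simp
      from ev[OF this] show "\<forall>\<^sub>F n in sequentially. prob {\<omega>\<in>space M. \<bar>X n \<omega> - Y \<omega>\<bar> \<ge> e} < r"
      proof eventually_elim
        case (elim n)
        have "prob {\<omega>\<in>space M. \<bar>X n \<omega> - Y \<omega>\<bar> \<ge> e} \<le> prob {\<omega>\<in>space M. \<bar>X n \<omega> - Y \<omega>\<bar> \<ge> min e r}"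
          by (intro finite_measure_mono) auto
        with elim show ?case by linarith
      qed
    qed (auto intro!: always_eventually intro: less_le_trans[OF _ measure_nonneg])
  qed
qed

end


section \<open>Elementary properties of \<open>kappa_bar\<close>\<close>

lemma L0_class_eq_iff:
  assumes "X \<in> borel_measurable M" "Y \<in> borel_measurable M"
  shows "L0_class M X = L0_class M Y \<longleftrightarrow> (AE \<omega> in M. X \<omega> = Y \<omega>)"
  unfolding L0_class_def using eq_equiv_class_iff[OF equiv_L0_rel assms] assms
  by (auto simp: L0_rel_def)

lemma UN_L0_class:
  assumes "X \<in> borel_measurable M"
    and "\<And>X'. (X, X') \<in> L0_rel M \<Longrightarrow> g X' \<in> borel_measurable M \<and> (AE \<omega> in M. g X \<omega> = g X' \<omega>)"
  shows "(\<Union>X'\<in>L0_class M X. L0_class M (g X')) = L0_class M (g X)"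
proof -
  have X: "X \<in> L0_class M X" using assms by (auto simp: L0_class_def L0_rel_def)
  then have gX: "g X \<in> borel_measurable M" using assms by (auto simp: L0_class_def)
  have "L0_class M (g X') = L0_class M (g X)" if "X' \<in> L0_class M X" for X'
    using assms(2)[of X'] that gX L0_class_eq_iff[of "g X" M "g X'"] by (auto simp: L0_class_def)
  with X show ?thesis by blast
qed

lemma L0_scale_class:
  assumes "X \<in> borel_measurable M"
  shows "L0_scale M c (L0_class M X) = L0_class M (\<lambda>\<omega>. c * X \<omega>)"
  unfolding L0_scale_def
  by (rule UN_L0_class[where g="\<lambda>X \<omega>. c * X \<omega>"]) (use assms in \<open>auto simp: L0_rel_def elim: AE_mp\<close>)

lemma L0_add_class:
  assumes X: "X \<in> borel_measurable M" and Y: "Y \<in> borel_measurable M"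
  shows "L0_add M (L0_class M X) (L0_class M Y) = L0_class M (\<lambda>\<omega>. X \<omega> + Y \<omega>)"
proof -
  have "(\<Union>Y'\<in>L0_class M Y. L0_class M (\<lambda>\<omega>. X' \<omega> + Y' \<omega>)) = L0_class M (\<lambda>\<omega>. X' \<omega> + Y \<omega>)"
    if "X' \<in> L0_class M X" for X'
    by (rule UN_L0_class[where g="\<lambda>Y' \<omega>. X' \<omega> + Y' \<omega>"])
       (use Y that in \<open>auto simp: L0_class_def L0_rel_def elim: AE_mp\<close>)
  then have "L0_add M (L0_class M X) (L0_class M Y)
      = (\<Union>X'\<in>L0_class M X. L0_class M (\<lambda>\<omega>. X' \<omega> + Y \<omega>))"
    unfolding L0_add_def by simp
  also have "\<dots> = L0_class M (\<lambda>\<omega>. X \<omega> + Y \<omega>)"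
    by (rule UN_L0_class[where g="\<lambda>X' \<omega>. X' \<omega> + Y \<omega>"])
       (use X Y in \<open>auto simp: L0_rel_def elim: AE_mp\<close>)
  finally show ?thesis .
qed

lemma space_dual_algebra: "space (dual_algebra T) = seq_dual T"
  unfolding dual_algebra_def by (rule space_measure_of) auto

lemma measurable_dual_eval:
  assumes "f \<in> topspace T"
  shows "(\<lambda>F. F f) \<in> borel_measurable (dual_algebra T)"
proof (rule measurableI)
  fix B :: "real set" assume "B \<in> sets borel"
  with assms show "(\<lambda>F. F f) -` B \<inter> space (dual_algebra T) \<in> sets (dual_algebra T)"
    unfolding space_dual_algebra unfolding dual_algebra_def
    by (subst sets_measure_of) (auto intro!: sigma_sets.Basic)
qed simp

context prob_space
begin

lemma kappa_bar_class:
  assumes X: "X \<in> measurable M (dual_algebra T)"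
  shows "kappa_bar M T (strict_rel M T `` {X}) = (\<lambda>f\<in>topspace T. L0_class M (\<lambda>\<omega>. X \<omega> f))"
proof -
  have eval: "(\<lambda>\<omega>. Y \<omega> f) \<in> borel_measurable M"
    if "Y \<in> measurable M (dual_algebra T)" "f \<in> topspace T" for Y f
    using measurable_compose[OF that(1) measurable_dual_eval[OF that(2)]] .
  have "L0_class M (\<lambda>\<omega>. Y \<omega> f) = L0_class M (\<lambda>\<omega>. X \<omega> f)"
    if XY: "(X, Y) \<in> strict_rel M T" and f: "f \<in> topspace T" for Y f
  proof -
    obtain A where A: "A \<in> sets M" "prob A = 1" "\<forall>\<omega>\<in>A. X \<omega> = Y \<omega>"
      and Y: "Y \<in> measurable M (dual_algebra T)"
      using XY by (auto simp: strict_rel_def)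
    have "AE \<omega> in M. \<omega> \<in> A" using A prob_eq_1 by blast
    then have "AE \<omega> in M. Y \<omega> f = X \<omega> f" by eventually_elim (use A in auto)
    then show ?thesis
      using L0_class_eq_iff[OF eval[OF Y f] eval[OF X f]] by simp
  qed
  moreover have "(X, X) \<in> strict_rel M T"
    using X prob_space by (auto simp: strict_rel_def intro!: bexI[of _ "space M"])
  ultimately have "(\<Union>Y\<in>strict_rel M T `` {X}. L0_class M (\<lambda>\<omega>. Y \<omega> f)) = L0_class M (\<lambda>\<omega>. X \<omega> f)"
    if "f \<in> topspace T" for f
    using that by blast
  then show ?thesis unfolding kappa_bar_def by (intro restrict_ext) simp
qed

lemma tendsto_prob_of_pointwise:
  assumes [measurable]: "\<And>n. X n \<in> borel_measurable M" "Y \<in> borel_measurable M"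
    and lim: "\<And>\<omega>. \<omega> \<in> space M \<Longrightarrow> (\<lambda>n. X n \<omega>) \<longlonglongrightarrow> Y \<omega>" and e: "(0::real) < e"
  shows "(\<lambda>n. prob {\<omega>\<in>space M. \<bar>X n \<omega> - Y \<omega>\<bar> \<ge> e}) \<longlonglongrightarrow> 0"
proof -
  let ?A = "\<lambda>n. {\<omega>\<in>space M. \<bar>X n \<omega> - Y \<omega>\<bar> \<ge> e}"
  have "(\<lambda>n. \<integral>\<omega>. indicator (?A n) \<omega> \<partial>M) \<longlonglongrightarrow> (\<integral>\<omega>. (0::real) \<partial>M)"
  proof (rule integral_dominated_convergence[where w="\<lambda>_. 1"])
    show "AE \<omega> in M. (\<lambda>n. indicator (?A n) \<omega> :: real) \<longlonglongrightarrow> 0"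
    proof (rule AE_I2)
      fix \<omega> assume "\<omega> \<in> space M"
      then have "\<forall>\<^sub>F n in sequentially. dist (X n \<omega>) (Y \<omega>) < e"
        using lim e tendstoD by blast
      then have "\<forall>\<^sub>F n in sequentially. indicator (?A n) \<omega> = (0::real)"
        by eventually_elim (auto simp: dist_real_def)
      then show "(\<lambda>n. indicator (?A n) \<omega> :: real) \<longlonglongrightarrow> 0"
        by (rule tendsto_eventually)
    qed
  qed (auto simp: indicator_def)
  then show ?thesis by simp
qed

lemma kappa_bar_in_Lc:
  assumes T: "locally_convex_topology T" and C: "C \<in> L0_dual M T"
  shows "kappa_bar M T C \<in> Lc M T"
proof -
  obtain X where X: "X \<in> measurable M (dual_algebra T)" and CX: "C = strict_rel M T `` {X}"
    using C unfolding L0_dual_def quotient_def by blast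
  have eval: "(\<lambda>\<omega>. X \<omega> f) \<in> borel_measurable M" if "f \<in> topspace T" for f
    using measurable_compose[OF X measurable_dual_eval[OF that]] .
  have dual: "X \<omega> \<in> seq_dual T" if "\<omega> \<in> space M" for \<omega>
    using measurable_space[OF X that] by (simp add: space_dual_algebra)
  have cong: "L0_class M Y = L0_class M Z"
    if "Y \<in> borel_measurable M" "Z \<in> borel_measurable M" "\<And>\<omega>. \<omega> \<in> space M \<Longrightarrow> Y \<omega> = Z \<omega>" for Y Z
    using L0_class_eq_iff[OF that(1,2)] that(3) by (auto intro: AE_I2)
  have sub: "subspace (topspace T)" using T by (simp add: locally_convex_topology_def)
  let ?\<phi> = "\<lambda>f\<in>topspace T. L0_class M (\<lambda>\<omega>. X \<omega> f)"
  have "?\<phi> \<in> Lc M T"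
    unfolding Lc_def
  proof (intro CollectI conjI ballI allI)
    fix x y assume xy: "x \<in> topspace T" "y \<in> topspace T"
    then have xy': "x + y \<in> topspace T" using sub subspace_add by blast
    have "L0_class M (\<lambda>\<omega>. X \<omega> (x + y)) = L0_class M (\<lambda>\<omega>. X \<omega> x + X \<omega> y)"
      by (rule cong) (use xy xy' eval dual in \<open>auto simp: seq_dual_def\<close>)
    then show "?\<phi> (x + y) = L0_add M (?\<phi> x) (?\<phi> y)"
      using xy xy' eval by (simp add: L0_add_class)
  next
    fix c x assume x: "x \<in> topspace T"
    then have x': "c *\<^sub>R x \<in> topspace T" using sub subspace_scale by blast
    have "L0_class M (\<lambda>\<omega>. X \<omega> (c *\<^sub>R x)) = L0_class M (\<lambda>\<omega>. c * X \<omega> x)"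
      by (rule cong) (use x x' eval dual in \<open>auto simp: seq_dual_def\<close>)
    then show "?\<phi> (c *\<^sub>R x) = L0_scale M c (?\<phi> x)"
      using x x' eval by (simp add: L0_scale_class)
  next
    show "seq_continuous_map T (L0_topology M) ?\<phi>"
      unfolding seq_continuous_map_def
    proof (intro conjI allI impI)
      show "?\<phi> \<in> topspace T \<rightarrow> topspace (L0_topology M)"
        using eval by (auto simp: topspace_L0_topology L0_class_in_L0)
      fix x l assume xl: "range x \<subseteq> topspace T \<and> limitin T x l sequentially"
      then have x: "\<And>n. x n \<in> topspace T" and l: "l \<in> topspace T"
        by (auto simp: limitin_def)
      have "(\<lambda>n. X \<omega> (x n)) \<longlonglongrightarrow> X \<omega> l" if "\<omega> \<in> space M" for \<omega>
        using dual[OF that] xl by (auto simp: seq_dual_def seq_continuous_map_def)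
      then have "limitin (L0_topology M) (\<lambda>n. L0_class M (\<lambda>\<omega>. X \<omega> (x n))) (L0_class M (\<lambda>\<omega>. X \<omega> l)) sequentially"
        using x l eval by (subst limitin_L0_topology) (auto intro!: tendsto_prob_of_pointwise)
      then show "limitin (L0_topology M) (\<lambda>n. ?\<phi> (x n)) (?\<phi> l) sequentially"
        using x l by simp
    qed
  qed simp
  then show ?thesis unfolding CX kappa_bar_class[OF X] .
qed

end

end

theory Submission
  imports Defs
begin

text \<open>
  Write \<open>E\<close> for the direct sum. Surjectivity of \<open>\<kappa>\<close> on a space means that every random functional
  \<open>\<phi>\<close> on it, that is, every sequentially continuous linear map into \<open>L\<^sup>0\<close>, is represented by a
  random variable \<open>X\<close> with values in the sequential dual (\<open>kappa_bar_surj_iff\<close>).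

  This property passes from a space to its retracts (\<open>kappa_bar_surj_retract\<close>): if
  \<open>P \<circ> J = id\<close> for continuous linear maps \<open>P\<close> and \<open>J\<close>, and \<open>X\<close> represents \<open>\<phi> \<circ> P\<close>, then
  \<open>X \<circ> J\<close> represents \<open>\<phi>\<close>. Each summand is a retract of \<open>E\<close>, through the coordinate projection and
  the injection, so surjectivity for \<open>E\<close> implies it for every summand.

  Conversely, let \<open>X\<^sub>\<gamma>\<close> represent \<open>\<phi> \<circ> \<iota>\<^sub>\<gamma>\<close> for each \<open>\<gamma>\<close>. The functional
  \<open>f \<mapsto> \<Sum>\<^sub>\<gamma> X\<^sub>\<gamma>(\<omega>)(f\<^sub>\<gamma>)\<close>, a finite sum for each \<open>f\<close>, is the natural candidate for a representative of
  \<open>\<phi>\<close>. It agrees with \<open>\<phi>\<close> at each \<open>f\<close> because \<open>f\<close> is a finite sum of elements of summands, so only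
  finitely many almost sure identities are combined, and for the same reason its evaluations are
  measurable. What has to be shown is that it belongs to the sequential dual of \<open>E\<close> for \<^emph>\<open>every\<close>
  \<open>\<omega>\<close>, however large the index set is (\<open>glue_in_seq_dual\<close>). This rests on the fact that the terms
  of a convergent sequence in \<open>E\<close> have their supports in one common finite set of indices
  (\<open>finite_keys_convergent_direct_sum\<close>): along such a sequence the candidate is a fixed finite sum
  of sequentially continuous functionals of the coordinates.

  Both the continuity of the projections and the finiteness of the supports come from one
  topological fact: every box \<open>{x \<in> E. \<forall>\<gamma>. x\<^sub>\<gamma> \<in> U\<^sub>\<gamma>}\<close> with open sides is open in \<open>E\<close>
  (\<open>openin_direct_sum_topology_box\<close>), because the box topology on the direct sum is locally convex
  and makes the injections continuous.
\<close>

section \<open>Boxes are open in the direct sum\<close>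

lemma lookup_scaleR [simp]:
  "Poly_Mapping.lookup (c *\<^sub>R x) i = c *\<^sub>R Poly_Mapping.lookup x i"
  by (simp add: scaleR_poly_mapping_def)

lemma poly_mapping_eq_sum_single:
  assumes "finite K" "Poly_Mapping.keys x \<subseteq> K"
  shows "x = (\<Sum>\<gamma>\<in>K. Poly_Mapping.single \<gamma> (Poly_Mapping.lookup x \<gamma>))"
proof (rule poly_mapping_eqI)
  fix i
  have "i \<notin> K \<Longrightarrow> Poly_Mapping.lookup x i = 0"
    using assms(2) by (auto simp: in_keys_iff)
  then show "Poly_Mapping.lookup x i =
      Poly_Mapping.lookup (\<Sum>\<gamma>\<in>K. Poly_Mapping.single \<gamma> (Poly_Mapping.lookup x \<gamma>)) i"
    using assms(1) by (cases "i \<in> K")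
      (auto simp: lookup_sum lookup_single when_def if_distrib[of "\<lambda>v. v = _"] sum.delta cong: if_cong)
qed

text \<open>
  For a family of sets \<open>U\<close>, the set \<^term>\<open>direct_sum \<Gamma> U\<close> is the box with sides \<open>U \<gamma>\<close>. The open sets
  are described by neighbourhoods rather than by a generating family, since finite intersections of
  boxes are boxes.
\<close>

definition box_topology :: "'i set \<Rightarrow> ('i \<Rightarrow> 'a::real_vector topology) \<Rightarrow> ('i \<Rightarrow>\<^sub>0 'a) topology"
  where "box_topology \<Gamma> T = topology (\<lambda>W. \<forall>x\<in>W. \<exists>U. (\<forall>\<gamma>\<in>\<Gamma>. openin (T \<gamma>) (U \<gamma>)) \<and>
           x \<in> direct_sum \<Gamma> U \<and> direct_sum \<Gamma> U \<subseteq> W)"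

lemma openin_box_topology:
  "openin (box_topology \<Gamma> T) W \<longleftrightarrow> (\<forall>x\<in>W. \<exists>U. (\<forall>\<gamma>\<in>\<Gamma>. openin (T \<gamma>) (U \<gamma>)) \<and>
     x \<in> direct_sum \<Gamma> U \<and> direct_sum \<Gamma> U \<subseteq> W)" (is "_ = ?P W")
proof -
  have "?P (V \<inter> W)" if V: "?P V" and W: "?P W" for V W
  proof
    fix x assume x: "x \<in> V \<inter> W"
    obtain A where A: "\<forall>\<gamma>\<in>\<Gamma>. openin (T \<gamma>) (A \<gamma>)" "x \<in> direct_sum \<Gamma> A" "direct_sum \<Gamma> A \<subseteq> V"
      using V x by blast
    obtain B where B: "\<forall>\<gamma>\<in>\<Gamma>. openin (T \<gamma>) (B \<gamma>)" "x \<in> direct_sum \<Gamma> B" "direct_sum \<Gamma> B \<subseteq> W"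
      using W x by blast
    have "direct_sum \<Gamma> (\<lambda>\<gamma>. A \<gamma> \<inter> B \<gamma>) = direct_sum \<Gamma> A \<inter> direct_sum \<Gamma> B"
      by (auto simp: direct_sum_def)
    with A B show "\<exists>U. (\<forall>\<gamma>\<in>\<Gamma>. openin (T \<gamma>) (U \<gamma>)) \<and> x \<in> direct_sum \<Gamma> U \<and> direct_sum \<Gamma> U \<subseteq> V \<inter> W"
      by (intro exI[of _ "\<lambda>\<gamma>. A \<gamma> \<inter> B \<gamma>"]) auto
  qed
  moreover have "?P (\<Union>\<K>)" if "\<forall>K\<in>\<K>. ?P K" for \<K>
  proof
    fix x assume "x \<in> \<Union>\<K>"
    then obtain K where K: "K \<in> \<K>" "x \<in> K" by blast
    with that obtain U where "\<forall>\<gamma>\<in>\<Gamma>. openin (T \<gamma>) (U \<gamma>)" "x \<in> direct_sum \<Gamma> U" "direct_sum \<Gamma> U \<subseteq> K"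
      by blast
    with K(1) show "\<exists>U. (\<forall>\<gamma>\<in>\<Gamma>. openin (T \<gamma>) (U \<gamma>)) \<and> x \<in> direct_sum \<Gamma> U \<and> direct_sum \<Gamma> U \<subseteq> \<Union>\<K>"
      by (intro exI[of _ U]) auto
  qed
  ultimately have "istopology ?P" unfolding istopology_def by simp
  then show ?thesis unfolding box_topology_def by (simp add: topology_inverse')
qed

lemma openin_box_topology_direct_sum:
  assumes "\<And>\<gamma>. \<gamma> \<in> \<Gamma> \<Longrightarrow> openin (T \<gamma>) (U \<gamma>)"
  shows "openin (box_topology \<Gamma> T) (direct_sum \<Gamma> U)"
  using assms unfolding openin_box_topology by blast

lemma topspace_box_topology:
  "topspace (box_topology \<Gamma> T) = direct_sum \<Gamma> (\<lambda>\<gamma>. topspace (T \<gamma>))" (is "_ = ?E")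
proof
  show "?E \<subseteq> topspace (box_topology \<Gamma> T)"
    by (intro openin_subset openin_box_topology_direct_sum) simp
  show "topspace (box_topology \<Gamma> T) \<subseteq> ?E"
  proof
    fix x assume "x \<in> topspace (box_topology \<Gamma> T)"
    then obtain U where "\<forall>\<gamma>\<in>\<Gamma>. openin (T \<gamma>) (U \<gamma>)" "x \<in> direct_sum \<Gamma> U"
      using openin_topspace[of "box_topology \<Gamma> T"] unfolding openin_box_topology by blast
    then show "x \<in> ?E" by (auto simp: direct_sum_def dest!: openin_subset)
  qed
qed

lemma continuous_map_into_box_topology:
  assumes "f \<in> topspace X \<rightarrow> direct_sum \<Gamma> (\<lambda>\<gamma>. topspace (T \<gamma>))"
    and nbh: "\<And>x U. \<lbrakk>x \<in> topspace X; \<And>\<gamma>. \<gamma> \<in> \<Gamma> \<Longrightarrow> openin (T \<gamma>) (U \<gamma>); f x \<in> direct_sum \<Gamma> U\<rbrakk>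
      \<Longrightarrow> \<exists>V. openin X V \<and> x \<in> V \<and> f ` V \<subseteq> direct_sum \<Gamma> U"
  shows "continuous_map X (box_topology \<Gamma> T) f"
  unfolding continuous_map_def topspace_box_topology
proof (intro conjI allI impI assms(1))
  fix W assume W: "openin (box_topology \<Gamma> T) W"
  show "openin X {x \<in> topspace X. f x \<in> W}"
  proof (subst openin_subopen, intro ballI)
    fix x assume x: "x \<in> {x \<in> topspace X. f x \<in> W}"
    then obtain U where U: "\<forall>\<gamma>\<in>\<Gamma>. openin (T \<gamma>) (U \<gamma>)" "f x \<in> direct_sum \<Gamma> U" "direct_sum \<Gamma> U \<subseteq> W"
      using W unfolding openin_box_topology by blast
    then obtain V where "openin X V" "x \<in> V" "f ` V \<subseteq> direct_sum \<Gamma> U"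
      using nbh[of x U] x by auto
    then show "\<exists>V. openin X V \<and> x \<in> V \<and> V \<subseteq> {x \<in> topspace X. f x \<in> W}"
      using U(3) openin_subset by (intro exI[of _ V]) blast
  qed
qed

lemma locally_convex_addition_nbhds:
  assumes "locally_convex_topology T" "openin T U" "x \<in> topspace T" "y \<in> topspace T" "x + y \<in> U"
  shows "\<exists>A B. openin T A \<and> openin T B \<and> x \<in> A \<and> y \<in> B \<and> (\<forall>a\<in>A. \<forall>b\<in>B. a + b \<in> U)"
proof -
  have "continuous_map (prod_topology T T) T (\<lambda>(x, y). x + y)"
    using assms(1) by (simp add: locally_convex_topology_def)
  from openin_continuous_map_preimage[OF this assms(2)]
  have "\<exists>A B. openin T A \<and> openin T B \<and> x \<in> A \<and> y \<in> B \<and>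
      A \<times> B \<subseteq> {z \<in> topspace (prod_topology T T). (case z of (x, y) \<Rightarrow> x + y) \<in> U}"
    unfolding openin_prod_topology_alt using assms(3-5) by auto
  then show ?thesis by fast
qed

lemma locally_convex_scaling_nbhds:
  assumes "locally_convex_topology T" "openin T U" "x \<in> topspace T" "c *\<^sub>R x \<in> U"
  shows "\<exists>I A. open I \<and> openin T A \<and> c \<in> I \<and> x \<in> A \<and> (\<forall>r\<in>I. \<forall>a\<in>A. r *\<^sub>R a \<in> U)"
proof -
  have "continuous_map (prod_topology euclideanreal T) T (\<lambda>(c, x). c *\<^sub>R x)"
    using assms(1) by (simp add: locally_convex_topology_def)
  from openin_continuous_map_preimage[OF this assms(2)]
  have "\<exists>I A. openin euclideanreal I \<and> openin T A \<and> c \<in> I \<and> x \<in> A \<and>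
      I \<times> A \<subseteq> {z \<in> topspace (prod_topology euclideanreal T). (case z of (c, x) \<Rightarrow> c *\<^sub>R x) \<in> U}"
    unfolding openin_prod_topology_alt using assms(3-4) by auto
  then show ?thesis by (simp add: open_openin[symmetric]) fast
qed

lemma continuous_map_scaleR_locally_convex:
  assumes "locally_convex_topology T"
  shows "continuous_map T T ((*\<^sub>R) c)"
proof -
  have scale: "continuous_map (prod_topology euclideanreal T) T (\<lambda>(c, x). c *\<^sub>R x)"
    using assms by (simp add: locally_convex_topology_def)
  have "continuous_map T (prod_topology euclideanreal T) (\<lambda>x. (c, x))"
    by (simp add: continuous_map_paired)
  from continuous_map_compose[OF this scale] show ?thesis
    by (simp add: o_def)
qed

text \<open>
  Scalar multiplication of a box has to be controlled on infinitely many coordinates by a single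
  range of scalars, so near zero one needs neighbourhoods that work for all \<open>\<bar>r\<bar> \<le> R\<close> at once.
  Convexity provides them: \<open>r a\<close> is a convex combination of \<open>R a\<close> and \<open>- R a\<close>.
\<close>

lemma locally_convex_bounded_scaling_nbhd:
  assumes T: "locally_convex_topology T" and U: "openin T U" "0 \<in> U"
  shows "\<exists>A. openin T A \<and> 0 \<in> A \<and> (\<forall>r. \<bar>r\<bar> \<le> R \<longrightarrow> (\<forall>a\<in>A. r *\<^sub>R a \<in> U))"
proof (cases "R > 0")
  case True
  obtain V where V: "openin T V" "convex V" "0 \<in> V" "V \<subseteq> U"
    using T U unfolding locally_convex_topology_def by blast
  define A where "A = {x \<in> topspace T. R *\<^sub>R x \<in> V} \<inter> {x \<in> topspace T. (- R) *\<^sub>R x \<in> V}"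
  have "openin T A"
    unfolding A_def
    by (intro openin_Int openin_continuous_map_preimage[OF continuous_map_scaleR_locally_convex[OF T] V(1)])
  moreover have "0 \<in> A" using V openin_subset by (auto simp: A_def)
  moreover have "r *\<^sub>R a \<in> U" if r: "\<bar>r\<bar> \<le> R" and a: "a \<in> A" for r a
  proof -
    have "r = (R + r) / (2 * R) * R + (R - r) / (2 * R) * (- R)"
      using True by (simp add: field_simps)
    then have eq: "r *\<^sub>R a = ((R + r) / (2 * R)) *\<^sub>R (R *\<^sub>R a) + ((R - r) / (2 * R)) *\<^sub>R ((- R) *\<^sub>R a)"
      by (metis scaleR_left_distrib scaleR_scaleR)
    have "((R + r) / (2 * R)) *\<^sub>R (R *\<^sub>R a) + ((R - r) / (2 * R)) *\<^sub>R ((- R) *\<^sub>R a) \<in> V"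
      using a r True by (intro convexD[OF V(2)]) (auto simp: A_def field_simps)
    with eq V(4) show ?thesis by auto
  qed
  ultimately show ?thesis by blast
next
  case False
  then have "r *\<^sub>R a \<in> U" if "\<bar>r\<bar> \<le> R" for r a
    using that U(2) by (cases "r = 0") auto
  then show ?thesis using U(2) openin_subset[OF U(1)]
    by (intro exI[of _ "topspace T"]) auto
qed

text \<open>
  Addition is handled coordinatewise. Scalar multiplication at \<open>(c, x)\<close> is the place where finite
  supports enter: on the finitely many coordinates in the support of \<open>x\<close> the neighbourhoods of \<open>c\<close>
  given by continuity can be intersected, while all other coordinates of \<open>x\<close> vanish and are governed
  by \<open>locally_convex_bounded_scaling_nbhd\<close> with the bound \<open>\<bar>c\<bar> + 1\<close>. On a full product of
  infinitely many spaces scalar multiplication need not be continuous for the box topology.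
\<close>

lemma locally_convex_box_topology:
  assumes lc: "\<And>\<gamma>. \<gamma> \<in> \<Gamma> \<Longrightarrow> locally_convex_topology (T \<gamma>)"
  shows "locally_convex_topology (box_topology \<Gamma> T)"
proof -
  let ?B = "box_topology \<Gamma> T" and ?E = "direct_sum \<Gamma> (\<lambda>\<gamma>. topspace (T \<gamma>))"
  let ?l = "Poly_Mapping.lookup"
  have sub: "subspace ?E"
    using lc by (intro subspace_direct_sum) (simp add: locally_convex_topology_def)
  have lookup: "?l x \<gamma> \<in> topspace (T \<gamma>)" if "x \<in> ?E" "\<gamma> \<in> \<Gamma>" for x \<gamma>
    using that by (simp add: direct_sum_def)
  have add: "continuous_map (prod_topology ?B ?B) ?B (\<lambda>(x, y). x + y)"
  proof (rule continuous_map_into_box_topology)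
    show "(\<lambda>(x, y). x + y) \<in> topspace (prod_topology ?B ?B) \<rightarrow> ?E"
      using sub by (auto simp: topspace_box_topology subspace_add)
    fix z U assume z: "z \<in> topspace (prod_topology ?B ?B)"
      and U: "\<And>\<gamma>. \<gamma> \<in> \<Gamma> \<Longrightarrow> openin (T \<gamma>) (U \<gamma>)" "(case z of (x, y) \<Rightarrow> x + y) \<in> direct_sum \<Gamma> U"
    obtain x y where xy: "z = (x, y)" "x \<in> ?E" "y \<in> ?E"
      using z by (auto simp: topspace_box_topology)
    have "\<forall>\<gamma>\<in>\<Gamma>. \<exists>A B. openin (T \<gamma>) A \<and> openin (T \<gamma>) B \<and> ?l x \<gamma> \<in> A \<and> ?l y \<gamma> \<in> B \<and>
        (\<forall>a\<in>A. \<forall>b\<in>B. a + b \<in> U \<gamma>)"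
    proof
      fix \<gamma> assume \<gamma>: "\<gamma> \<in> \<Gamma>"
      have "?l x \<gamma> + ?l y \<gamma> \<in> U \<gamma>"
        using U(2) xy(1) \<gamma> by (simp add: direct_sum_def lookup_add)
      from locally_convex_addition_nbhds[OF lc[OF \<gamma>] U(1)[OF \<gamma>] lookup[OF xy(2) \<gamma>] lookup[OF xy(3) \<gamma>] this]
      show "\<exists>A B. openin (T \<gamma>) A \<and> openin (T \<gamma>) B \<and> ?l x \<gamma> \<in> A \<and> ?l y \<gamma> \<in> B \<and>
        (\<forall>a\<in>A. \<forall>b\<in>B. a + b \<in> U \<gamma>)" .
    qed
    then obtain A B where AB: "\<And>\<gamma>. \<gamma> \<in> \<Gamma> \<Longrightarrow> openin (T \<gamma>) (A \<gamma>) \<and> openin (T \<gamma>) (B \<gamma>) \<and>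
        ?l x \<gamma> \<in> A \<gamma> \<and> ?l y \<gamma> \<in> B \<gamma> \<and> (\<forall>a\<in>A \<gamma>. \<forall>b\<in>B \<gamma>. a + b \<in> U \<gamma>)"
      by metis
    have "openin (prod_topology ?B ?B) (direct_sum \<Gamma> A \<times> direct_sum \<Gamma> B)"
      using AB by (auto simp: openin_prod_Times_iff intro!: openin_box_topology_direct_sum)
    moreover have "z \<in> direct_sum \<Gamma> A \<times> direct_sum \<Gamma> B"
      using AB xy by (auto simp: direct_sum_def)
    moreover have "(\<lambda>(x, y). x + y) ` (direct_sum \<Gamma> A \<times> direct_sum \<Gamma> B) \<subseteq> direct_sum \<Gamma> U"
    proof clarify
      fix a b assume "a \<in> direct_sum \<Gamma> A" "b \<in> direct_sum \<Gamma> B"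
      then show "a + b \<in> direct_sum \<Gamma> U"
        using AB keys_add[of a b] by (auto simp: direct_sum_def lookup_add)
    qed
    ultimately show "\<exists>V. openin (prod_topology ?B ?B) V \<and> z \<in> V \<and> (\<lambda>(x, y). x + y) ` V \<subseteq> direct_sum \<Gamma> U"
      by blast
  qed
  have scale: "continuous_map (prod_topology euclideanreal ?B) ?B (\<lambda>(c, x). c *\<^sub>R x)"
  proof (rule continuous_map_into_box_topology)
    show "(\<lambda>(c, x). c *\<^sub>R x) \<in> topspace (prod_topology euclideanreal ?B) \<rightarrow> ?E"
      using sub by (auto simp: topspace_box_topology subspace_scale)
    fix z U assume z: "z \<in> topspace (prod_topology euclideanreal ?B)"
      and U: "\<And>\<gamma>. \<gamma> \<in> \<Gamma> \<Longrightarrow> openin (T \<gamma>) (U \<gamma>)" "(case z of (c, x) \<Rightarrow> c *\<^sub>R x) \<in> direct_sum \<Gamma> U"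
    obtain c x where cx: "z = (c, x)" "x \<in> ?E"
      using z by (auto simp: topspace_box_topology)
    let ?K = "Poly_Mapping.keys x"
    have K: "?K \<subseteq> \<Gamma>" using cx by (simp add: direct_sum_def)
    have "\<forall>\<gamma>\<in>?K. \<exists>I A. open I \<and> openin (T \<gamma>) A \<and> c \<in> I \<and> ?l x \<gamma> \<in> A \<and>
        (\<forall>r\<in>I. \<forall>a\<in>A. r *\<^sub>R a \<in> U \<gamma>)"
    proof
      fix \<gamma> assume "\<gamma> \<in> ?K"
      then have \<gamma>: "\<gamma> \<in> \<Gamma>" using K by blast
      have "c *\<^sub>R ?l x \<gamma> \<in> U \<gamma>" using U(2) cx(1) \<gamma> by (simp add: direct_sum_def)
      from locally_convex_scaling_nbhds[OF lc[OF \<gamma>] U(1)[OF \<gamma>] lookup[OF cx(2) \<gamma>] this]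
      show "\<exists>I A. open I \<and> openin (T \<gamma>) A \<and> c \<in> I \<and> ?l x \<gamma> \<in> A \<and>
        (\<forall>r\<in>I. \<forall>a\<in>A. r *\<^sub>R a \<in> U \<gamma>)" .
    qed
    then obtain I A where IA: "\<And>\<gamma>. \<gamma> \<in> ?K \<Longrightarrow> open (I \<gamma>) \<and> openin (T \<gamma>) (A \<gamma>) \<and> c \<in> I \<gamma> \<and>
        ?l x \<gamma> \<in> A \<gamma> \<and> (\<forall>r\<in>I \<gamma>. \<forall>a\<in>A \<gamma>. r *\<^sub>R a \<in> U \<gamma>)"
      by metis
    have zero: "?l x \<gamma> = 0" if "\<gamma> \<in> \<Gamma> - ?K" for \<gamma>
      using that by (simp add: in_keys_iff)
    have "\<forall>\<gamma>\<in>\<Gamma> - ?K. \<exists>A. openin (T \<gamma>) A \<and> 0 \<in> A \<and>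
        (\<forall>r. \<bar>r\<bar> \<le> \<bar>c\<bar> + 1 \<longrightarrow> (\<forall>a\<in>A. r *\<^sub>R a \<in> U \<gamma>))"
    proof
      fix \<gamma> assume \<gamma>: "\<gamma> \<in> \<Gamma> - ?K"
      then have \<gamma>': "\<gamma> \<in> \<Gamma>" by simp
      have "c *\<^sub>R ?l x \<gamma> \<in> U \<gamma>" using U(2) cx(1) \<gamma> by (simp add: direct_sum_def)
      then have "0 \<in> U \<gamma>" using zero[OF \<gamma>] by simp
      from locally_convex_bounded_scaling_nbhd[OF lc[OF \<gamma>'] U(1)[OF \<gamma>'] this]
      show "\<exists>A. openin (T \<gamma>) A \<and> 0 \<in> A \<and>
        (\<forall>r. \<bar>r\<bar> \<le> \<bar>c\<bar> + 1 \<longrightarrow> (\<forall>a\<in>A. r *\<^sub>R a \<in> U \<gamma>))" .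
    qed
    then obtain A' where A': "\<And>\<gamma>. \<gamma> \<in> \<Gamma> - ?K \<Longrightarrow> openin (T \<gamma>) (A' \<gamma>) \<and> 0 \<in> A' \<gamma> \<and>
        (\<forall>r. \<bar>r\<bar> \<le> \<bar>c\<bar> + 1 \<longrightarrow> (\<forall>a\<in>A' \<gamma>. r *\<^sub>R a \<in> U \<gamma>))"
      by metis
    \<comment> \<open>The unit ball keeps the scalars within the bound used on the coordinates off the support.\<close>
    define J where "J = ball c 1 \<inter> (\<Inter>\<gamma>\<in>?K. I \<gamma>)"
    define D where "D = direct_sum \<Gamma> (\<lambda>\<gamma>. if \<gamma> \<in> ?K then A \<gamma> else A' \<gamma>)"
    have J: "open J" "c \<in> J"
      unfolding J_def using IA by (auto intro!: open_Int open_INT)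
    have bound: "\<bar>r\<bar> \<le> \<bar>c\<bar> + 1" if "r \<in> J" for r
      using that by (auto simp: J_def dist_real_def)
    have "openin ?B D"
      unfolding D_def using IA A' K by (intro openin_box_topology_direct_sum) auto
    with J have "openin (prod_topology euclideanreal ?B) (J \<times> D)"
      by (simp add: openin_prod_Times_iff open_openin[symmetric])
    moreover have "z \<in> J \<times> D"
      using J cx IA A' zero K by (auto simp: D_def direct_sum_def)
    moreover have "(\<lambda>(c, x). c *\<^sub>R x) ` (J \<times> D) \<subseteq> direct_sum \<Gamma> U"
    proof clarify
      fix r d assume r: "r \<in> J" and d: "d \<in> D"
      have "Poly_Mapping.keys (r *\<^sub>R d) \<subseteq> \<Gamma>"
        using d by (auto simp: D_def direct_sum_def in_keys_iff)
      moreover have "r *\<^sub>R ?l d \<gamma> \<in> U \<gamma>" if "\<gamma> \<in> \<Gamma>" for \<gamma>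
      proof (cases "\<gamma> \<in> ?K")
        case True
        then show ?thesis using IA[OF True] r d that by (auto simp: J_def D_def direct_sum_def)
      next
        case False
        then show ?thesis using A'[of \<gamma>] bound[OF r] d that by (auto simp: D_def direct_sum_def)
      qed
      ultimately show "r *\<^sub>R d \<in> direct_sum \<Gamma> U" by (simp add: direct_sum_def)
    qed
    ultimately show "\<exists>V. openin (prod_topology euclideanreal ?B) V \<and> z \<in> V \<and>
        (\<lambda>(c, x). c *\<^sub>R x) ` V \<subseteq> direct_sum \<Gamma> U"
      by blast
  qed
  have conv: "\<exists>V. openin ?B V \<and> convex V \<and> 0 \<in> V \<and> V \<subseteq> W" if W: "openin ?B W" "0 \<in> W" for W
  proof -
    obtain U where U: "\<forall>\<gamma>\<in>\<Gamma>. openin (T \<gamma>) (U \<gamma>)" "0 \<in> direct_sum \<Gamma> U" "direct_sum \<Gamma> U \<subseteq> W"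
      using W unfolding openin_box_topology by blast
    have "\<forall>\<gamma>\<in>\<Gamma>. \<exists>V. openin (T \<gamma>) V \<and> convex V \<and> 0 \<in> V \<and> V \<subseteq> U \<gamma>"
      using U(1,2) lc unfolding locally_convex_topology_def by (auto simp: direct_sum_def)
    then obtain V where V: "\<And>\<gamma>. \<gamma> \<in> \<Gamma> \<Longrightarrow> openin (T \<gamma>) (V \<gamma>) \<and> convex (V \<gamma>) \<and> 0 \<in> V \<gamma> \<and> V \<gamma> \<subseteq> U \<gamma>"
      by metis
    have "convex (direct_sum \<Gamma> V)"
      unfolding convex_def
    proof (intro ballI allI impI)
      fix x y and u v :: real
      assume *: "x \<in> direct_sum \<Gamma> V" "y \<in> direct_sum \<Gamma> V" "0 \<le> u" "0 \<le> v" "u + v = 1"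
      have keys: "Poly_Mapping.keys x \<subseteq> \<Gamma>" "Poly_Mapping.keys y \<subseteq> \<Gamma>"
        using *(1,2) by (simp_all add: direct_sum_def)
      have "\<gamma> \<in> \<Gamma>" if "\<gamma> \<in> Poly_Mapping.keys (u *\<^sub>R x + v *\<^sub>R y)" for \<gamma>
      proof (rule ccontr)
        assume "\<gamma> \<notin> \<Gamma>"
        then have "?l x \<gamma> = 0" "?l y \<gamma> = 0" using keys by (auto simp: in_keys_iff)
        then show False using that by (simp add: in_keys_iff lookup_add)
      qed
      moreover have "u *\<^sub>R ?l x \<gamma> + v *\<^sub>R ?l y \<gamma> \<in> V \<gamma>" if \<gamma>: "\<gamma> \<in> \<Gamma>" for \<gamma>
      proof (rule convexD)
        show "convex (V \<gamma>)" using V[OF \<gamma>] by blast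
        show "?l x \<gamma> \<in> V \<gamma>" "?l y \<gamma> \<in> V \<gamma>" using *(1,2) \<gamma> by (simp_all add: direct_sum_def)
      qed (use *(3-5) in simp_all)
      ultimately show "u *\<^sub>R x + v *\<^sub>R y \<in> direct_sum \<Gamma> V"
        by (auto simp: direct_sum_def lookup_add)
    qed
    moreover have "direct_sum \<Gamma> V \<subseteq> W"
    proof
      fix x assume "x \<in> direct_sum \<Gamma> V"
      then have "x \<in> direct_sum \<Gamma> U" using V unfolding direct_sum_def by blast
      with U(3) show "x \<in> W" by blast
    qed
    moreover have "0 \<in> direct_sum \<Gamma> V" using V by (simp add: direct_sum_def)
    moreover have "openin ?B (direct_sum \<Gamma> V)"
      using V by (intro openin_box_topology_direct_sum) blast
    ultimately show ?thesis by blast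
  qed
  show ?thesis
    unfolding locally_convex_topology_def topspace_box_topology
    using sub add scale conv by blast
qed

lemma box_topology_in_direct_sum_topologies:
  assumes lc: "\<And>\<gamma>. \<gamma> \<in> \<Gamma> \<Longrightarrow> locally_convex_topology (T \<gamma>)"
  shows "box_topology \<Gamma> T \<in> direct_sum_topologies \<Gamma> T"
proof -
  have "continuous_map (T \<gamma>) (box_topology \<Gamma> T) (Poly_Mapping.single \<gamma>)" if \<gamma>: "\<gamma> \<in> \<Gamma>" for \<gamma>
  proof (rule continuous_map_into_box_topology)
    show "Poly_Mapping.single \<gamma> \<in> topspace (T \<gamma>) \<rightarrow> direct_sum \<Gamma> (\<lambda>\<gamma>. topspace (T \<gamma>))"
      using lc \<gamma> by (auto simp: locally_convex_topology_def intro!: single_in_direct_sum)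
    fix x U assume *: "x \<in> topspace (T \<gamma>)" "\<And>\<delta>. \<delta> \<in> \<Gamma> \<Longrightarrow> openin (T \<delta>) (U \<delta>)"
      "Poly_Mapping.single \<gamma> x \<in> direct_sum \<Gamma> U"
    have "Poly_Mapping.single \<gamma> y \<in> direct_sum \<Gamma> U" if "y \<in> U \<gamma>" for y
      using *(3) that \<gamma> by (auto simp: direct_sum_def lookup_single when_def split: if_splits)
    moreover have "x \<in> U \<gamma>" using *(3) \<gamma> by (auto simp: direct_sum_def)
    ultimately show "\<exists>V. openin (T \<gamma>) V \<and> x \<in> V \<and> Poly_Mapping.single \<gamma> ` V \<subseteq> direct_sum \<Gamma> U"
      using *(2)[OF \<gamma>] by blast
  qed
  moreover have "locally_convex_topology (box_topology \<Gamma> T)"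
    by (rule locally_convex_box_topology) (fact lc)
  ultimately show ?thesis
    by (simp add: direct_sum_topologies_def topspace_box_topology)
qed

lemma openin_direct_sum_topology_box:
  assumes "\<And>\<gamma>. \<gamma> \<in> \<Gamma> \<Longrightarrow> locally_convex_topology (T \<gamma>)"
    and "\<And>\<gamma>. \<gamma> \<in> \<Gamma> \<Longrightarrow> openin (T \<gamma>) (U \<gamma>)"
  shows "openin (direct_sum_topology \<Gamma> T) (direct_sum \<Gamma> U)"
proof (rule direct_sum_topology_finest)
  show "box_topology \<Gamma> T \<in> direct_sum_topologies \<Gamma> T"
    by (rule box_topology_in_direct_sum_topologies) (rule assms(1))
  show "openin (box_topology \<Gamma> T) (direct_sum \<Gamma> U)"
    by (rule openin_box_topology_direct_sum) (rule assms(2))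
qed


section \<open>Projections and convergent sequences of the direct sum\<close>

lemma continuous_map_direct_sum_lookup:
  assumes lc: "\<And>\<gamma>. \<gamma> \<in> \<Gamma> \<Longrightarrow> locally_convex_topology (T \<gamma>)" and \<gamma>: "\<gamma> \<in> \<Gamma>"
  shows "continuous_map (direct_sum_topology \<Gamma> T) (T \<gamma>) (\<lambda>x. Poly_Mapping.lookup x \<gamma>)"
proof -
  let ?E = "direct_sum \<Gamma> (\<lambda>\<gamma>. topspace (T \<gamma>))"
  have "openin (direct_sum_topology \<Gamma> T) {x \<in> ?E. Poly_Mapping.lookup x \<gamma> \<in> U}"
    if U: "openin (T \<gamma>) U" for U
  proof -
    have "{x \<in> ?E. Poly_Mapping.lookup x \<gamma> \<in> U} =
        direct_sum \<Gamma> (\<lambda>\<delta>. if \<delta> = \<gamma> then U else topspace (T \<delta>))"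
      using \<gamma> openin_subset[OF U] by (auto simp: direct_sum_def split: if_splits)
    moreover have "openin (direct_sum_topology \<Gamma> T)
        (direct_sum \<Gamma> (\<lambda>\<delta>. if \<delta> = \<gamma> then U else topspace (T \<delta>)))"
      by (rule openin_direct_sum_topology_box) (use lc U in auto)
    ultimately show ?thesis by simp
  qed
  moreover have "Poly_Mapping.lookup x \<gamma> \<in> topspace (T \<gamma>)" if "x \<in> ?E" for x
    using that \<gamma> by (simp add: direct_sum_def)
  moreover have "topspace (direct_sum_topology \<Gamma> T) = ?E"
    using lc by (rule topspace_direct_sum_topology)
  ultimately show ?thesis
    unfolding continuous_map_def by auto
qed

lemma continuous_map_direct_sum_single:
  assumes lc: "\<And>\<gamma>. \<gamma> \<in> \<Gamma> \<Longrightarrow> locally_convex_topology (T \<gamma>)" and "\<gamma> \<in> \<Gamma>"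
  shows "continuous_map (T \<gamma>) (direct_sum_topology \<Gamma> T) (Poly_Mapping.single \<gamma>)"
proof -
  have "direct_sum_topology \<Gamma> T \<in> direct_sum_topologies \<Gamma> T"
    by (rule direct_sum_topology_in) (fact lc)
  with assms(2) show ?thesis by (simp add: direct_sum_topologies_def)
qed

text \<open>
  Suppose an index \<open>\<gamma>\<close> outside the support of the limit \<open>l\<close> occurs in the support of some term
  \<open>x (n \<gamma>)\<close>. Deleting the nonzero point \<open>x (n \<gamma>) \<gamma>\<close> from the Hausdorff summand leaves an open set which still
  contains \<open>l \<gamma> = 0\<close>. Doing so for all these \<open>\<gamma>\<close> simultaneously gives a box around \<open>l\<close>, which
  contains all \<open>x k\<close> with \<open>k \<ge> N\<close>. Hence \<open>n \<gamma> < N\<close> always, and only the finitely many indices in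
  the supports of \<open>x 0, \<dots>, x (N - 1)\<close> can arise.
\<close>

lemma finite_keys_convergent_direct_sum:
  assumes lcs: "\<And>\<gamma>. \<gamma> \<in> \<Gamma> \<Longrightarrow> locally_convex_space (T \<gamma>)"
    and x: "range x \<subseteq> topspace (direct_sum_topology \<Gamma> T)"
    and lim: "limitin (direct_sum_topology \<Gamma> T) x l sequentially"
  shows "finite (\<Union>n. Poly_Mapping.keys (x n))"
proof -
  let ?l = "Poly_Mapping.lookup"
  have lc: "\<And>\<gamma>. \<gamma> \<in> \<Gamma> \<Longrightarrow> locally_convex_topology (T \<gamma>)"
    using lcs by (simp add: locally_convex_space_def)
  have ts: "topspace (direct_sum_topology \<Gamma> T) = direct_sum \<Gamma> (\<lambda>\<gamma>. topspace (T \<gamma>))"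
    using lc by (rule topspace_direct_sum_topology)
  define D where "D = (\<Union>n. Poly_Mapping.keys (x n)) - Poly_Mapping.keys l"
  have "\<forall>\<gamma>\<in>D. \<exists>n. ?l (x n) \<gamma> \<noteq> 0" by (auto simp: D_def in_keys_iff)
  then obtain n where n: "\<And>\<gamma>. \<gamma> \<in> D \<Longrightarrow> ?l (x (n \<gamma>)) \<gamma> \<noteq> 0" by metis
  define U where "U \<gamma> = (if \<gamma> \<in> D then topspace (T \<gamma>) - {?l (x (n \<gamma>)) \<gamma>} else topspace (T \<gamma>))" for \<gamma>
  have U: "openin (T \<gamma>) (U \<gamma>)" if "\<gamma> \<in> \<Gamma>" for \<gamma>
    using lcs[OF that] Hausdorff_imp_t1_space[of "T \<gamma>"]
    by (auto simp: U_def locally_convex_space_def t1_space_openin_delete_alt)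
  have open_box: "openin (direct_sum_topology \<Gamma> T) (direct_sum \<Gamma> U)"
    by (rule openin_direct_sum_topology_box) (fact lc, fact U)
  have "l \<in> direct_sum \<Gamma> (\<lambda>\<gamma>. topspace (T \<gamma>))"
    using lim ts by (simp add: limitin_def)
  moreover have "?l l \<gamma> = 0" if "\<gamma> \<in> D" for \<gamma>
    using that by (auto simp: D_def in_keys_iff)
  ultimately have "l \<in> direct_sum \<Gamma> U"
    using n by (fastforce simp: direct_sum_def U_def)
  with lim open_box obtain N where N: "\<And>k. k \<ge> N \<Longrightarrow> x k \<in> direct_sum \<Gamma> U"
    by (auto simp: limitin_def eventually_sequentially)
  have D\<Gamma>: "D \<subseteq> \<Gamma>" using x ts by (auto simp: D_def direct_sum_def)
  have "n \<gamma> < N" if "\<gamma> \<in> D" for \<gamma>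
  proof (rule ccontr)
    assume "\<not> n \<gamma> < N"
    then have "x (n \<gamma>) \<in> direct_sum \<Gamma> U" using N by simp
    then have "?l (x (n \<gamma>)) \<gamma> \<in> U \<gamma>" using that D\<Gamma> by (auto simp: direct_sum_def)
    then show False using that by (simp add: U_def)
  qed
  then have "D \<subseteq> (\<Union>k<N. Poly_Mapping.keys (x k))"
    using n by (fastforce simp: in_keys_iff)
  then have "finite D" by (rule finite_subset) simp
  then show ?thesis
    unfolding D_def by simp
qed


section \<open>Precomposition with continuous linear maps\<close>

text \<open>
  Linearity is required on \<^term>\<open>topspace T\<close> only, because the values outside are arbitrary; the
  domain must then itself be a linear space for composites to be linear on it.
\<close>

definition continuous_linear_map :: "'a::real_vector topology \<Rightarrow> 'b::real_vector topology \<Rightarrow> ('a \<Rightarrow> 'b) \<Rightarrow> bool"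
  where "continuous_linear_map T S A \<longleftrightarrow> subspace (topspace T) \<and> continuous_map T S A \<and>
     (\<forall>x\<in>topspace T. \<forall>y\<in>topspace T. A (x + y) = A x + A y) \<and>
     (\<forall>c. \<forall>x\<in>topspace T. A (c *\<^sub>R x) = c *\<^sub>R A x)"

lemma continuous_linear_map_in_topspace:
  "continuous_linear_map T S A \<Longrightarrow> x \<in> topspace T \<Longrightarrow> A x \<in> topspace S"
  by (auto simp: continuous_linear_map_def continuous_map_def)

lemma seq_continuous_map_compose_continuous:
  assumes A: "continuous_map T S A" and \<phi>: "seq_continuous_map S R \<phi>"
  shows "seq_continuous_map T R (\<lambda>x\<in>topspace T. \<phi> (A x))"
proof -
  have in_S: "A x \<in> topspace S" if "x \<in> topspace T" for x
    using A that by (auto simp: continuous_map_def)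
  show ?thesis
    unfolding seq_continuous_map_def
  proof (intro conjI allI impI)
    show "(\<lambda>x\<in>topspace T. \<phi> (A x)) \<in> topspace T \<rightarrow> topspace R"
      using in_S \<phi> by (auto simp: seq_continuous_map_def)
    fix x l assume xl: "range x \<subseteq> topspace T \<and> limitin T x l sequentially"
    then have x: "\<And>n. x n \<in> topspace T" and l: "l \<in> topspace T"
      by (auto simp: limitin_def)
    have "limitin S (\<lambda>n. A (x n)) (A l) sequentially"
      using continuous_map_limit[OF A] xl by (auto simp: o_def)
    moreover have "range (\<lambda>n. A (x n)) \<subseteq> topspace S"
      using x in_S by auto
    ultimately have "limitin R (\<lambda>n. \<phi> (A (x n))) (\<phi> (A l)) sequentially"
      using \<phi> unfolding seq_continuous_map_def by blast
    then show "limitin R (\<lambda>n. (\<lambda>x\<in>topspace T. \<phi> (A x)) (x n)) ((\<lambda>x\<in>topspace T. \<phi> (A x)) l) sequentially"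
      using x l by simp
  qed
qed

lemma seq_dual_compose:
  assumes A: "continuous_linear_map T S A" and F: "F \<in> seq_dual S"
  shows "(\<lambda>x\<in>topspace T. F (A x)) \<in> seq_dual T"
proof -
  have "seq_continuous_map T euclideanreal (\<lambda>x\<in>topspace T. F (A x))"
    using A F by (intro seq_continuous_map_compose_continuous) (auto simp: continuous_linear_map_def seq_dual_def)
  then show ?thesis
    using A F continuous_linear_map_in_topspace[OF A]
    by (simp add: seq_dual_def continuous_linear_map_def subspace_add subspace_scale)
qed

lemma Lc_compose:
  assumes A: "continuous_linear_map T S A" and \<phi>: "\<phi> \<in> Lc M S"
  shows "(\<lambda>x\<in>topspace T. \<phi> (A x)) \<in> Lc M T"
proof -
  have "seq_continuous_map T (L0_topology M) (\<lambda>x\<in>topspace T. \<phi> (A x))"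
    using A \<phi> by (intro seq_continuous_map_compose_continuous) (auto simp: continuous_linear_map_def Lc_def)
  then show ?thesis
    using A \<phi> continuous_linear_map_in_topspace[OF A]
    by (simp add: Lc_def continuous_linear_map_def subspace_add subspace_scale)
qed

lemma locally_convex_direct_sum_topology:
  assumes lc: "\<And>\<gamma>. \<gamma> \<in> \<Gamma> \<Longrightarrow> locally_convex_topology (T \<gamma>)"
  shows "locally_convex_topology (direct_sum_topology \<Gamma> T)"
proof -
  have "direct_sum_topology \<Gamma> T \<in> direct_sum_topologies \<Gamma> T"
    by (rule direct_sum_topology_in) (fact lc)
  then show ?thesis unfolding direct_sum_topologies_def by blast
qed

lemma continuous_linear_map_lookup:
  assumes lc: "\<And>\<gamma>. \<gamma> \<in> \<Gamma> \<Longrightarrow> locally_convex_topology (T \<gamma>)" and \<gamma>: "\<gamma> \<in> \<Gamma>"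
  shows "continuous_linear_map (direct_sum_topology \<Gamma> T) (T \<gamma>) (\<lambda>x. Poly_Mapping.lookup x \<gamma>)"
proof -
  have "locally_convex_topology (direct_sum_topology \<Gamma> T)"
    by (rule locally_convex_direct_sum_topology) (fact lc)
  then have "subspace (topspace (direct_sum_topology \<Gamma> T))"
    unfolding locally_convex_topology_def by blast
  moreover have "continuous_map (direct_sum_topology \<Gamma> T) (T \<gamma>) (\<lambda>x. Poly_Mapping.lookup x \<gamma>)"
    by (rule continuous_map_direct_sum_lookup) (fact lc, fact \<gamma>)
  ultimately show ?thesis
    by (simp add: continuous_linear_map_def lookup_add)
qed

lemma continuous_linear_map_single:
  assumes lc: "\<And>\<gamma>. \<gamma> \<in> \<Gamma> \<Longrightarrow> locally_convex_topology (T \<gamma>)" and \<gamma>: "\<gamma> \<in> \<Gamma>"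
  shows "continuous_linear_map (T \<gamma>) (direct_sum_topology \<Gamma> T) (Poly_Mapping.single \<gamma>)"
proof -
  have "continuous_map (T \<gamma>) (direct_sum_topology \<Gamma> T) (Poly_Mapping.single \<gamma>)"
    by (rule continuous_map_direct_sum_single) (fact lc, fact \<gamma>)
  moreover have "\<forall>c. \<forall>x\<in>topspace (T \<gamma>).
      Poly_Mapping.single \<gamma> (c *\<^sub>R x) = c *\<^sub>R Poly_Mapping.single \<gamma> x"
    by (intro allI ballI poly_mapping_eqI) (simp add: lookup_single when_def)
  ultimately show ?thesis
    using lc[OF \<gamma>] by (simp add: continuous_linear_map_def locally_convex_topology_def single_add)
qed


section \<open>Representing random functionals\<close>

lemma measurable_dual_algebraI:
  assumes "\<And>\<omega>. \<omega> \<in> space M \<Longrightarrow> X \<omega> \<in> seq_dual T"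
    and "\<And>f. f \<in> topspace T \<Longrightarrow> (\<lambda>\<omega>. X \<omega> f) \<in> borel_measurable M"
  shows "X \<in> measurable M (dual_algebra T)"
  unfolding dual_algebra_def
proof (rule measurable_measure_of)
  fix y assume "y \<in> {(\<lambda>F. F f) -` B \<inter> seq_dual T | f B. f \<in> topspace T \<and> B \<in> sets (borel :: real measure)}"
  then obtain f B where y: "y = (\<lambda>F. F f) -` B \<inter> seq_dual T" "f \<in> topspace T" "B \<in> sets (borel :: real measure)"
    by auto
  have "X -` y \<inter> space M = (\<lambda>\<omega>. X \<omega> f) -` B \<inter> space M"
    using assms(1) y(1) by auto
  also have "\<dots> \<in> sets M"
    using assms(2)[OF y(2)] y(3) by (rule measurable_sets)
  finally show "X -` y \<inter> space M \<in> sets M" .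
qed (use assms(1) in auto)

lemma measurable_dual_algebra_eval:
  assumes "X \<in> measurable M (dual_algebra T)" "f \<in> topspace T"
  shows "(\<lambda>\<omega>. X \<omega> f) \<in> borel_measurable M"
  using measurable_compose[OF assms(1) measurable_dual_eval[OF assms(2)]] .

lemma measurable_dual_algebra_in_seq_dual:
  assumes "X \<in> measurable M (dual_algebra T)" "\<omega> \<in> space M"
  shows "X \<omega> \<in> seq_dual T"
  using measurable_space[OF assms] by (simp add: space_dual_algebra)

context prob_space
begin

text \<open>
  The image of \<open>\<kappa>\<close> always lies in \<^term>\<open>Lc M T\<close>, so only the other inclusion is at stake; and as
  each class modulo strict equivalence comes from a random variable, it can be tested without
  classes.
\<close>

lemma kappa_bar_surj_iff:
  assumes T: "locally_convex_topology T"
  shows "kappa_bar M T ` L0_dual M T = Lc M T \<longleftrightarrow>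
    (\<forall>\<phi>\<in>Lc M T. \<exists>X\<in>measurable M (dual_algebra T). \<forall>f\<in>topspace T. \<phi> f = L0_class M (\<lambda>\<omega>. X \<omega> f))"
proof -
  let ?g = "\<lambda>X. \<lambda>f\<in>topspace T. L0_class M (\<lambda>\<omega>. X \<omega> f)"
  have "L0_dual M T = (\<lambda>X. strict_rel M T `` {X}) ` measurable M (dual_algebra T)"
    by (auto simp: L0_dual_def quotient_def)
  then have image: "kappa_bar M T ` L0_dual M T = ?g ` measurable M (dual_algebra T)"
    by (simp add: image_image kappa_bar_class cong: image_cong)
  have sub: "kappa_bar M T ` L0_dual M T \<subseteq> Lc M T"
    using kappa_bar_in_Lc[OF T] by blast
  have eq: "\<phi> = ?g X \<longleftrightarrow> (\<forall>f\<in>topspace T. \<phi> f = L0_class M (\<lambda>\<omega>. X \<omega> f))"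
    if "\<phi> \<in> Lc M T" for \<phi> X
  proof
    assume *: "\<forall>f\<in>topspace T. \<phi> f = L0_class M (\<lambda>\<omega>. X \<omega> f)"
    have "\<phi> \<in> extensional (topspace T)" using that by (simp add: Lc_def)
    then show "\<phi> = ?g X"
      by (rule extensionalityI[OF _ restrict_extensional]) (use * in simp)
  qed simp
  have "kappa_bar M T ` L0_dual M T = Lc M T \<longleftrightarrow> (\<forall>\<phi>\<in>Lc M T. \<phi> \<in> ?g ` measurable M (dual_algebra T))"
    using sub unfolding image by blast
  also have "\<dots> \<longleftrightarrow> (\<forall>\<phi>\<in>Lc M T. \<exists>X\<in>measurable M (dual_algebra T). \<phi> = ?g X)"
    by (simp only: image_iff)
  finally show ?thesis by (simp only: eq cong: ball_cong)
qed

lemma kappa_bar_surj_retract: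
  assumes T: "locally_convex_topology T" and S: "locally_convex_topology S"
    and P: "continuous_linear_map T S P" and J: "continuous_linear_map S T J"
    and PJ: "\<And>x. x \<in> topspace S \<Longrightarrow> P (J x) = x"
    and surj: "kappa_bar M T ` L0_dual M T = Lc M T"
  shows "kappa_bar M S ` L0_dual M S = Lc M S"
  unfolding kappa_bar_surj_iff[OF S]
proof
  fix \<phi> assume "\<phi> \<in> Lc M S"
  then have "(\<lambda>x\<in>topspace T. \<phi> (P x)) \<in> Lc M T"
    by (rule Lc_compose[OF P])
  then obtain X where X: "X \<in> measurable M (dual_algebra T)"
    "\<And>f. f \<in> topspace T \<Longrightarrow> \<phi> (P f) = L0_class M (\<lambda>\<omega>. X \<omega> f)"
    using surj unfolding kappa_bar_surj_iff[OF T] by fastforce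
  define Y where "Y \<omega> = (\<lambda>x\<in>topspace S. X \<omega> (J x))" for \<omega>
  have "Y \<in> measurable M (dual_algebra S)"
  proof (rule measurable_dual_algebraI)
    show "Y \<omega> \<in> seq_dual S" if "\<omega> \<in> space M" for \<omega>
      unfolding Y_def by (intro seq_dual_compose[OF J] measurable_dual_algebra_in_seq_dual[OF X(1) that])
    show "(\<lambda>\<omega>. Y \<omega> f) \<in> borel_measurable M" if "f \<in> topspace S" for f
      using measurable_dual_algebra_eval[OF X(1) continuous_linear_map_in_topspace[OF J that]] that
      by (simp add: Y_def)
  qed
  moreover have "\<phi> f = L0_class M (\<lambda>\<omega>. Y \<omega> f)" if "f \<in> topspace S" for f
    using X(2)[OF continuous_linear_map_in_topspace[OF J that]] PJ[OF that] that by (simp add: Y_def)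
  ultimately show "\<exists>X\<in>measurable M (dual_algebra S). \<forall>f\<in>topspace S. \<phi> f = L0_class M (\<lambda>\<omega>. X \<omega> f)"
    by blast
qed

lemma Lc_zero:
  assumes \<phi>: "\<phi> \<in> Lc M T" and T: "subspace (topspace T)"
  shows "\<phi> 0 = L0_class M (\<lambda>\<omega>. 0)"
proof -
  have 0: "0 \<in> topspace T" using T by (rule subspace_0)
  then have "\<phi> 0 \<in> L0 M"
    using \<phi> by (auto simp: Lc_def seq_continuous_map_def topspace_L0_topology)
  then obtain Y where Y: "Y \<in> borel_measurable M" "\<phi> 0 = L0_class M Y"
    by (auto simp: L0_def L0_class_def quotient_def)
  have "\<phi> (0 *\<^sub>R 0) = L0_scale M 0 (\<phi> 0)"
    using \<phi> 0 unfolding Lc_def by blast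
  then show ?thesis using Y by (simp add: L0_scale_class)
qed

lemma Lc_sum:
  assumes \<phi>: "\<phi> \<in> Lc M T" and T: "subspace (topspace T)" and "finite K"
    and "\<And>i. i \<in> K \<Longrightarrow> x i \<in> topspace T"
    and "\<And>i. i \<in> K \<Longrightarrow> Y i \<in> borel_measurable M"
    and "\<And>i. i \<in> K \<Longrightarrow> \<phi> (x i) = L0_class M (Y i)"
  shows "\<phi> (\<Sum>i\<in>K. x i) = L0_class M (\<lambda>\<omega>. \<Sum>i\<in>K. Y i \<omega>)"
  using assms(3-6)
proof (induction K)
  case empty
  show ?case using Lc_zero[OF \<phi> T] by simp
next
  case (insert i K)
  have "(\<Sum>i\<in>K. x i) \<in> topspace T"
    using insert.prems T by (intro subspace_sum) auto
  moreover have "x i \<in> topspace T" using insert.prems by simp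
  ultimately have "\<phi> (x i + (\<Sum>i\<in>K. x i)) = L0_add M (\<phi> (x i)) (\<phi> (\<Sum>i\<in>K. x i))"
    using \<phi> by (simp add: Lc_def)
  also have "\<phi> (\<Sum>i\<in>K. x i) = L0_class M (\<lambda>\<omega>. \<Sum>i\<in>K. Y i \<omega>)"
    using insert.prems by (intro insert.IH) auto
  also have "L0_add M (\<phi> (x i)) (L0_class M (\<lambda>\<omega>. \<Sum>i\<in>K. Y i \<omega>)) = L0_class M (\<lambda>\<omega>. Y i \<omega> + (\<Sum>i\<in>K. Y i \<omega>))"
    using insert.prems by (simp add: L0_add_class)
  finally show ?case using insert.hyps by simp
qed

end


section \<open>Gluing functionals on the summands\<close>

definition glue :: "'i set \<Rightarrow> ('i \<Rightarrow> 'a::real_vector topology) \<Rightarrow> ('i \<Rightarrow> 'a \<Rightarrow> real) \<Rightarrow> ('i \<Rightarrow>\<^sub>0 'a) \<Rightarrow> real"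
  where "glue \<Gamma> T F = (\<lambda>x\<in>topspace (direct_sum_topology \<Gamma> T).
     \<Sum>\<gamma>\<in>Poly_Mapping.keys x. F \<gamma> (Poly_Mapping.lookup x \<gamma>))"

lemma seq_dual_zero:
  assumes "F \<in> seq_dual T" "subspace (topspace T)"
  shows "F 0 = 0"
proof -
  have "F (0 *\<^sub>R 0) = 0 * F 0"
    using assms subspace_0 unfolding seq_dual_def by blast
  then show ?thesis by simp
qed

text \<open>
  Enlarging the support to a common index set makes the functional a sum over a fixed set, which is
  what the proofs of linearity and continuity need.
\<close>

lemma glue_eq_sum:
  assumes lc: "\<And>\<gamma>. \<gamma> \<in> \<Gamma> \<Longrightarrow> locally_convex_topology (T \<gamma>)"
    and F: "\<And>\<gamma>. \<gamma> \<in> \<Gamma> \<Longrightarrow> F \<gamma> \<in> seq_dual (T \<gamma>)"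
    and x: "x \<in> topspace (direct_sum_topology \<Gamma> T)"
    and K: "finite K" "Poly_Mapping.keys x \<subseteq> K" "K \<subseteq> \<Gamma>"
  shows "glue \<Gamma> T F x = (\<Sum>\<gamma>\<in>K. F \<gamma> (Poly_Mapping.lookup x \<gamma>))"
proof -
  have "F \<gamma> (Poly_Mapping.lookup x \<gamma>) = 0" if "\<gamma> \<in> K - Poly_Mapping.keys x" for \<gamma>
  proof -
    have "\<gamma> \<in> \<Gamma>" and "Poly_Mapping.lookup x \<gamma> = 0" using that K(3) by (auto simp: in_keys_iff)
    then show ?thesis
      using seq_dual_zero[OF F] lc by (simp add: locally_convex_topology_def)
  qed
  then show ?thesis
    unfolding glue_def using x K by (auto intro!: sum.mono_neutral_left)
qed

text \<open>
  A convergent sequence and its limit live on a finite index set \<open>K\<close>. There the glued functional is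
  a finite sum of compositions of projections with sequentially continuous functionals.
\<close>

lemma glue_in_seq_dual:
  assumes lcs: "\<And>\<gamma>. \<gamma> \<in> \<Gamma> \<Longrightarrow> locally_convex_space (T \<gamma>)"
    and F: "\<And>\<gamma>. \<gamma> \<in> \<Gamma> \<Longrightarrow> F \<gamma> \<in> seq_dual (T \<gamma>)"
  shows "glue \<Gamma> T F \<in> seq_dual (direct_sum_topology \<Gamma> T)"
proof -
  let ?S = "direct_sum_topology \<Gamma> T" and ?l = "Poly_Mapping.lookup" and ?k = "Poly_Mapping.keys"
  have lc: "\<And>\<gamma>. \<gamma> \<in> \<Gamma> \<Longrightarrow> locally_convex_topology (T \<gamma>)"
    using lcs by (simp add: locally_convex_space_def)
  have ts: "topspace ?S = direct_sum \<Gamma> (\<lambda>\<gamma>. topspace (T \<gamma>))"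
    by (rule topspace_direct_sum_topology) (fact lc)
  have sub: "subspace (topspace ?S)"
    unfolding ts by (rule subspace_direct_sum) (use lc in \<open>simp add: locally_convex_topology_def\<close>)
  have lookup: "?l x \<gamma> \<in> topspace (T \<gamma>)" if "x \<in> topspace ?S" "\<gamma> \<in> \<Gamma>" for x \<gamma>
    using that by (simp add: ts direct_sum_def)
  have keys: "?k x \<subseteq> \<Gamma>" if "x \<in> topspace ?S" for x
    using that by (simp add: ts direct_sum_def)
  have eq: "glue \<Gamma> T F x = (\<Sum>\<gamma>\<in>K. F \<gamma> (?l x \<gamma>))"
    if "x \<in> topspace ?S" "finite K" "?k x \<subseteq> K" "K \<subseteq> \<Gamma>" for x K
    by (rule glue_eq_sum) (use lc F that in auto)
  have "glue \<Gamma> T F (x + y) = glue \<Gamma> T F x + glue \<Gamma> T F y"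
    if x: "x \<in> topspace ?S" and y: "y \<in> topspace ?S" for x y
  proof -
    let ?K = "?k x \<union> ?k y"
    have K: "?K \<subseteq> \<Gamma>" using keys x y by blast
    have "F \<gamma> (?l x \<gamma> + ?l y \<gamma>) = F \<gamma> (?l x \<gamma>) + F \<gamma> (?l y \<gamma>)" if "\<gamma> \<in> ?K" for \<gamma>
    proof -
      have "\<gamma> \<in> \<Gamma>" using that K by blast
      with F[of \<gamma>] lookup[OF x] lookup[OF y] show ?thesis by (simp add: seq_dual_def)
    qed
    then show ?thesis
      using K x y sub keys_add[of x y]
      by (simp add: eq[of _ ?K] subspace_add lookup_add sum.distrib)
  qed
  moreover have "glue \<Gamma> T F (c *\<^sub>R x) = c * glue \<Gamma> T F x" if x: "x \<in> topspace ?S" for c x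
  proof -
    have K: "?k x \<subseteq> \<Gamma>" using keys x by blast
    have "?k (c *\<^sub>R x) \<subseteq> ?k x" by (auto simp: in_keys_iff)
    moreover have "F \<gamma> (c *\<^sub>R ?l x \<gamma>) = c * F \<gamma> (?l x \<gamma>)" if "\<gamma> \<in> ?k x" for \<gamma>
    proof -
      have "\<gamma> \<in> \<Gamma>" using that K by blast
      with F[of \<gamma>] lookup[OF x] show ?thesis by (simp add: seq_dual_def)
    qed
    ultimately show ?thesis
      using K x sub by (simp add: eq[of _ "?k x"] subspace_scale sum_distrib_left)
  qed
  moreover have "seq_continuous_map ?S euclideanreal (glue \<Gamma> T F)"
    unfolding seq_continuous_map_def
  proof (intro conjI allI impI)
    fix x l assume xl: "range x \<subseteq> topspace ?S \<and> limitin ?S x l sequentially"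
    then have x: "\<And>n. x n \<in> topspace ?S" and l: "l \<in> topspace ?S"
      by (auto simp: limitin_def)
    have fin: "finite (\<Union>n. ?k (x n))"
      by (rule finite_keys_convergent_direct_sum[where T=T and \<Gamma>=\<Gamma> and l=l]) (use lcs xl in auto)
    define K where "K = (\<Union>n. ?k (x n)) \<union> ?k l"
    have K: "finite K" "?k l \<subseteq> K" "\<And>n. ?k (x n) \<subseteq> K" "K \<subseteq> \<Gamma>"
      using fin keys x l by (auto simp: K_def)
    have "(\<lambda>n. F \<gamma> (?l (x n) \<gamma>)) \<longlonglongrightarrow> F \<gamma> (?l l \<gamma>)" if "\<gamma> \<in> K" for \<gamma>
    proof -
      have \<gamma>: "\<gamma> \<in> \<Gamma>" using that K(4) by blast
      have "continuous_map ?S (T \<gamma>) (\<lambda>x. ?l x \<gamma>)"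
        by (rule continuous_map_direct_sum_lookup) (fact lc, fact \<gamma>)
      then have "limitin (T \<gamma>) (\<lambda>n. ?l (x n) \<gamma>) (?l l \<gamma>) sequentially"
        using continuous_map_limit xl by (fastforce simp: o_def)
      moreover have "range (\<lambda>n. ?l (x n) \<gamma>) \<subseteq> topspace (T \<gamma>)"
        using lookup[OF x \<gamma>] by auto
      ultimately have "limitin euclideanreal (\<lambda>n. F \<gamma> (?l (x n) \<gamma>)) (F \<gamma> (?l l \<gamma>)) sequentially"
        using F[OF \<gamma>] unfolding seq_dual_def seq_continuous_map_def by blast
      then show ?thesis by simp
    qed
    then have "(\<lambda>n. \<Sum>\<gamma>\<in>K. F \<gamma> (?l (x n) \<gamma>)) \<longlonglongrightarrow> (\<Sum>\<gamma>\<in>K. F \<gamma> (?l l \<gamma>))"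
      by (rule tendsto_sum)
    then show "limitin euclideanreal (\<lambda>n. glue \<Gamma> T F (x n)) (glue \<Gamma> T F l) sequentially"
      using eq[OF l K(1,2,4)] eq[OF x K(1,3,4)] by simp
  qed simp
  moreover have "glue \<Gamma> T F \<in> extensional (topspace ?S)"
    by (simp add: glue_def)
  ultimately show ?thesis by (simp add: seq_dual_def)
qed

text \<open>
  The representatives for the single summands are glued pathwise. The choice of a representative for
  each of possibly uncountably many \<open>\<gamma>\<close> causes no null set problem, since every evaluation involves
  only finitely many of them.
\<close>

lemma (in prob_space) kappa_bar_surj_direct_sum:
  assumes lcs: "\<And>\<gamma>. \<gamma> \<in> \<Gamma> \<Longrightarrow> locally_convex_space (T \<gamma>)"
    and surj: "\<And>\<gamma>. \<gamma> \<in> \<Gamma> \<Longrightarrow> kappa_bar M (T \<gamma>) ` L0_dual M (T \<gamma>) = Lc M (T \<gamma>)"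
  shows "kappa_bar M (direct_sum_topology \<Gamma> T) ` L0_dual M (direct_sum_topology \<Gamma> T)
           = Lc M (direct_sum_topology \<Gamma> T)"
proof -
  let ?S = "direct_sum_topology \<Gamma> T" and ?l = "Poly_Mapping.lookup" and ?k = "Poly_Mapping.keys"
  have lc: "\<And>\<gamma>. \<gamma> \<in> \<Gamma> \<Longrightarrow> locally_convex_topology (T \<gamma>)"
    using lcs by (simp add: locally_convex_space_def)
  have ts: "topspace ?S = direct_sum \<Gamma> (\<lambda>\<gamma>. topspace (T \<gamma>))"
    by (rule topspace_direct_sum_topology) (fact lc)
  have lcS: "locally_convex_topology ?S"
    by (rule locally_convex_direct_sum_topology) (fact lc)
  show ?thesis
    unfolding kappa_bar_surj_iff[OF lcS]
  proof
    fix \<phi> assume \<phi>: "\<phi> \<in> Lc M ?S"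
    have "\<exists>X\<in>measurable M (dual_algebra (T \<gamma>)).
        \<forall>f\<in>topspace (T \<gamma>). \<phi> (Poly_Mapping.single \<gamma> f) = L0_class M (\<lambda>\<omega>. X \<omega> f)"
      if \<gamma>: "\<gamma> \<in> \<Gamma>" for \<gamma>
    proof -
      have "continuous_linear_map (T \<gamma>) ?S (Poly_Mapping.single \<gamma>)"
        by (rule continuous_linear_map_single) (fact lc, fact \<gamma>)
      from Lc_compose[OF this \<phi>] show ?thesis
        using surj[OF \<gamma>] unfolding kappa_bar_surj_iff[OF lc[OF \<gamma>]] by fastforce
    qed
    then obtain X where X: "\<And>\<gamma>. \<gamma> \<in> \<Gamma> \<Longrightarrow> X \<gamma> \<in> measurable M (dual_algebra (T \<gamma>))"
      "\<And>\<gamma> f. \<gamma> \<in> \<Gamma> \<Longrightarrow> f \<in> topspace (T \<gamma>) \<Longrightarrow>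
         \<phi> (Poly_Mapping.single \<gamma> f) = L0_class M (\<lambda>\<omega>. X \<gamma> \<omega> f)"
      by metis
    define Z where "Z \<omega> = glue \<Gamma> T (\<lambda>\<gamma>. X \<gamma> \<omega>)" for \<omega>
    have Z: "Z \<omega> f = (\<Sum>\<gamma>\<in>?k f. X \<gamma> \<omega> (?l f \<gamma>))" if "f \<in> topspace ?S" for \<omega> f
      using that by (simp add: Z_def glue_def)
    have eval: "(\<lambda>\<omega>. X \<gamma> \<omega> (?l f \<gamma>)) \<in> borel_measurable M"
      if "f \<in> topspace ?S" "\<gamma> \<in> ?k f" for f \<gamma>
    proof (rule measurable_dual_algebra_eval)
      have "\<gamma> \<in> \<Gamma>" using that ts by (auto simp: direct_sum_def)
      then show "X \<gamma> \<in> measurable M (dual_algebra (T \<gamma>))" "?l f \<gamma> \<in> topspace (T \<gamma>)"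
        using X(1) that(1) ts by (auto simp: direct_sum_def)
    qed
    have "Z \<in> measurable M (dual_algebra ?S)"
    proof (rule measurable_dual_algebraI)
      show "Z \<omega> \<in> seq_dual ?S" if "\<omega> \<in> space M" for \<omega>
        unfolding Z_def
        by (rule glue_in_seq_dual) (use lcs measurable_dual_algebra_in_seq_dual[OF X(1) that] in auto)
      show "(\<lambda>\<omega>. Z \<omega> f) \<in> borel_measurable M" if "f \<in> topspace ?S" for f
        using eval[OF that] by (simp add: Z[OF that])
    qed
    moreover have "\<phi> f = L0_class M (\<lambda>\<omega>. Z \<omega> f)" if f: "f \<in> topspace ?S" for f
    proof -
      have lookup: "\<gamma> \<in> \<Gamma>" "?l f \<gamma> \<in> topspace (T \<gamma>)" if "\<gamma> \<in> ?k f" for \<gamma>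
        using that f ts by (auto simp: direct_sum_def)
      have single: "Poly_Mapping.single \<gamma> (?l f \<gamma>) \<in> topspace ?S" if "\<gamma> \<in> ?k f" for \<gamma>
        unfolding ts using lc lookup[OF that]
        by (intro single_in_direct_sum) (auto simp: locally_convex_topology_def)
      have "\<phi> f = \<phi> (\<Sum>\<gamma>\<in>?k f. Poly_Mapping.single \<gamma> (?l f \<gamma>))"
        using poly_mapping_eq_sum_single[of "?k f" f] by simp
      also have "\<dots> = L0_class M (\<lambda>\<omega>. \<Sum>\<gamma>\<in>?k f. X \<gamma> \<omega> (?l f \<gamma>))"
        using lcS eval[OF f] single X(2) lookup
        by (intro Lc_sum[OF \<phi>]) (auto simp: locally_convex_topology_def)
      finally show ?thesis by (simp add: Z[OF f])
    qed
    ultimately show "\<exists>X\<in>measurable M (dual_algebra ?S). \<forall>f\<in>topspace ?S. \<phi> f = L0_class M (\<lambda>\<omega>. X \<omega> f)"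
      by blast
  qed
qed


section \<open>Surjectivity on a direct sum\<close>

theorem proposition6p3:
  fixes M :: "'w measure" and \<Gamma> :: "'i set" and T :: "'i \<Rightarrow> 'a::real_vector topology"
  assumes "prob_space M"
    and "\<And>\<gamma>. \<gamma> \<in> \<Gamma> \<Longrightarrow> locally_convex_space (T \<gamma>)"
  shows "kappa_bar M (direct_sum_topology \<Gamma> T) ` L0_dual M (direct_sum_topology \<Gamma> T)
           = Lc M (direct_sum_topology \<Gamma> T)
    \<longleftrightarrow> (\<forall>\<gamma>\<in>\<Gamma>. kappa_bar M (T \<gamma>) ` L0_dual M (T \<gamma>) = Lc M (T \<gamma>))"
proof -
  interpret prob_space M by fact
  have lc: "\<And>\<gamma>. \<gamma> \<in> \<Gamma> \<Longrightarrow> locally_convex_topology (T \<gamma>)"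
    using assms(2) by (simp add: locally_convex_space_def)
  have lcS: "locally_convex_topology (direct_sum_topology \<Gamma> T)"
    by (rule locally_convex_direct_sum_topology) (fact lc)
  show ?thesis
  proof (intro iffI ballI)
    fix \<gamma> assume \<gamma>: "\<gamma> \<in> \<Gamma>" and surj: "kappa_bar M (direct_sum_topology \<Gamma> T) `
      L0_dual M (direct_sum_topology \<Gamma> T) = Lc M (direct_sum_topology \<Gamma> T)"
    show "kappa_bar M (T \<gamma>) ` L0_dual M (T \<gamma>) = Lc M (T \<gamma>)"
    proof (rule kappa_bar_surj_retract[OF lcS lc[OF \<gamma>] _ _ _ surj])
      show "continuous_linear_map (direct_sum_topology \<Gamma> T) (T \<gamma>) (\<lambda>x. Poly_Mapping.lookup x \<gamma>)"
        by (rule continuous_linear_map_lookup) (fact lc, fact \<gamma>)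
      show "continuous_linear_map (T \<gamma>) (direct_sum_topology \<Gamma> T) (Poly_Mapping.single \<gamma>)"
        by (rule continuous_linear_map_single) (fact lc, fact \<gamma>)
    qed simp
  next
    assume "\<forall>\<gamma>\<in>\<Gamma>. kappa_bar M (T \<gamma>) ` L0_dual M (T \<gamma>) = Lc M (T \<gamma>)"
    then show "kappa_bar M (direct_sum_topology \<Gamma> T) `
      L0_dual M (direct_sum_topology \<Gamma> T) = Lc M (direct_sum_topology \<Gamma> T)"
      using assms(2) by (intro kappa_bar_surj_direct_sum) blast+
  qed
qed

end
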